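(* There exist absolute constants $c_1,c_2,C_1,C_2>0$ such that, for any positive integers $p=p_n$ and positive reals $\sigma=\sigma_n$, $\Delta=\Delta_n$ (possibly depending on $n$), for all $n$ large enough, $$C_1e^{-c_1\mathbf r_n^2}\le\Psi_\Delta\le C_2e^{-c_2\mathbf r_n^2},\qquad\text{where } \mathbf r_n=\frac{\Delta^2/\sigma^2}{\sqrt{\Delta^2/\sigma^2+p/n}} .$$
   Context: Model: for $n\ge 2$, $p\ge1$, $\sigma>0$, one observes $Y_i=\boldsymbol\theta\eta_i+\sigma\xi_i\in\mathbf R^p$, $i=1,\dots,n$, where $\boldsymbol\theta\in\mathbf R^p$ and $\eta\in\{-1,1\}^n$ are unknown and $\xi_1,\dots,\xi_n$ are i.i.d. standard Gaussian vectors in $\mathbf R^p$. $Y$ is the $p\times n$ matrix with columns $Y_1,\dots,Y_n$; $\mathbf E_{(\boldsymbol\theta,\eta)}$ is expectation under the law of $Y$. $\|\cdot\|$ is the Euclidean norm. $\Omega_\Delta=\{\boldsymbol\theta\in\mathbf R^p:\|\boldsymbol\theta\|\ge\Delta\}\times\{-1,1\}^n$. Loss: $r(\hat\eta,\eta)=\min_{\nu\in\{-1,1\}}\sum_{j=1}^n|\hat\eta_j-\nu\eta_j|$. Minimax risk: $\Psi_\Delta=\inf_{\tilde\eta}\sup_{(\boldsymbol\theta,\eta)\in\Omega_\Delta}\frac1n\mathbf E_{(\boldsymbol\theta,\eta)}r(\tilde\eta,\eta)$, the infimum being over all measurable functions $\tilde\eta$ of $Y$ with values in $\{-1,1\}^n$.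 The parameters $p,\sigma,\Delta$ may depend on $n$. *)

theory Defs
  imports "HOL-Probability.Probability"
begin

text \<open>
  A \<open>p \<times> n\<close> matrix is a function \<open>Y :: nat \<Rightarrow> nat \<Rightarrow> real\<close> listing its columns: \<open>Y i\<close> is the
  \<open>i\<close>-th column, for \<open>i < n\<close>, and \<open>Y i k\<close> its \<open>k\<close>-th entry, for \<open>k < p\<close>.
\<close>

definition obs_space :: "nat \<Rightarrow> nat \<Rightarrow> (nat \<Rightarrow> nat \<Rightarrow> real) measure" where
  "obs_space n p = (\<Pi>\<^sub>M i\<in>{..<n}. \<Pi>\<^sub>M k\<in>{..<p}. (borel :: real measure))"

definition noise :: "nat \<Rightarrow> nat \<Rightarrow> (nat \<Rightarrow> nat \<Rightarrow> real) measure" where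
  "noise n p = (\<Pi>\<^sub>M i\<in>{..<n}. \<Pi>\<^sub>M k\<in>{..<p}. std_normal_distribution)"

definition observation ::
    "nat \<Rightarrow> nat \<Rightarrow> real \<Rightarrow> (nat \<Rightarrow> real) \<Rightarrow> (nat \<Rightarrow> real) \<Rightarrow> (nat \<Rightarrow> nat \<Rightarrow> real) \<Rightarrow> nat \<Rightarrow> nat \<Rightarrow> real" where
  "observation n p \<sigma> \<theta> \<eta> \<xi> = (\<lambda>i\<in>{..<n}. \<lambda>k\<in>{..<p}. \<theta> k * \<eta> i + \<sigma> * \<xi> i k)"

definition obs_law ::
    "nat \<Rightarrow> nat \<Rightarrow> real \<Rightarrow> (nat \<Rightarrow> real) \<Rightarrow> (nat \<Rightarrow> real) \<Rightarrow> (nat \<Rightarrow> nat \<Rightarrow> real) measure" where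
  "obs_law n p \<sigma> \<theta> \<eta> = distr (noise n p) (obs_space n p) (observation n p \<sigma> \<theta> \<eta>)"

definition labels :: "nat \<Rightarrow> (nat \<Rightarrow> real) set" where
  "labels n = {..<n} \<rightarrow>\<^sub>E {-1, 1}"

definition params :: "nat \<Rightarrow> nat \<Rightarrow> real \<Rightarrow> ((nat \<Rightarrow> real) \<times> (nat \<Rightarrow> real)) set" where
  "params n p \<Delta> = {\<theta> \<in> {..<p} \<rightarrow>\<^sub>E UNIV. L2_set \<theta> {..<p} \<ge> \<Delta>} \<times> labels n"

definition loss :: "nat \<Rightarrow> (nat \<Rightarrow> real) \<Rightarrow> (nat \<Rightarrow> real) \<Rightarrow> real" where
  "loss n \<eta>' \<eta> = (MIN \<nu>\<in>{-1, 1}. \<Sum>j<n. \<bar>\<eta>' j - \<nu> * \<eta> j\<bar>)"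

definition estimators :: "nat \<Rightarrow> nat \<Rightarrow> ((nat \<Rightarrow> nat \<Rightarrow> real) \<Rightarrow> nat \<Rightarrow> real) set" where
  "estimators n p = obs_space n p \<rightarrow>\<^sub>M count_space (labels n)"

text \<open>
  The loss of an estimator takes values in \<open>[0, 2 * n]\<close>, so for \<open>n, p > 0\<close> the supremum and the infimum
  below are taken over nonempty bounded sets of reals.
\<close>

definition minimax_risk :: "nat \<Rightarrow> nat \<Rightarrow> real \<Rightarrow> real \<Rightarrow> real" where
  "minimax_risk n p \<sigma> \<Delta> =
     (INF est\<in>estimators n p. SUP (\<theta>, \<eta>)\<in>params n p \<Delta>.
        1 / real n * (\<integral>Y. loss n (est Y) \<eta> \<partial>obs_law n p \<sigma> \<theta> \<eta>))"

definition snr :: "nat \<Rightarrow> nat \<Rightarrow> real \<Rightarrow> real \<Rightarrow> real" where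
  "snr n p \<sigma> \<Delta> = (\<Delta>\<^sup>2 / \<sigma>\<^sup>2) / sqrt (\<Delta>\<^sup>2 / \<sigma>\<^sup>2 + real p / real n)"

end

theory Submission imports Defs begin

text \<open>
  Both bounds hold for every \<open>n \<ge> 2\<close> with \<open>c1 = 4\<close>, \<open>C1 = 1 / 8\<close>, \<open>c2 = 1 / 16\<close> and \<open>C2 = 4 * exp 1 + 1\<close>.
  Write \<open>s = \<Delta>\<^sup>2 / \<sigma>\<^sup>2\<close>, so that the squared signal-to-noise ratio is \<open>r\<^sup>2 = s\<^sup>2 / (s + p / n)\<close>, which is
  of the order of the minimum of \<open>s\<close> (the price of one label if \<open>\<theta>\<close> is known) and of \<open>n * s\<^sup>2 / p\<close> (the price of
  not knowing the direction of \<open>\<theta>\<close>).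

  Lower bound. The loss dominates, up to the factor \<open>n\<close>, the number of pairs \<open>(i, j)\<close> for which the estimator gets
  the product of the two labels wrong (\<open>loss_ge_pairs\<close>). It suffices to test, for each pair, one label vector against
  the one with the label of \<open>j\<close> reversed, when the entries of \<open>\<theta>\<close> are independent random signs times
  \<open>\<Delta> / sqrt p\<close>. With respect to pure noise both mixtures have product densities over the coordinates, with factors
  that are hyperbolic cosines of linear forms. Their Hellinger affinity can be bounded below coordinatewise by
  \<open>1 - (1 - exp (- (n - 1) * \<delta>\<^sup>2)) * (1 - exp (- \<delta>\<^sup>2))\<close>, where \<open>\<delta>\<^sup>2 = s / p\<close>
  (\<open>coordinate_affinity_ge\<close>). The product over the \<open>p\<close> coordinates is at least \<open>exp (- 2 * r\<^sup>2)\<close> in all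
  regimes of \<open>p\<close>, \<open>n\<close> and \<open>s\<close> at once (\<open>affinity_exponent_le_snr\<close>), and an affinity \<open>b\<close> forces the two
  errors of any test to sum to at least \<open>b\<^sup>2 / 2\<close>.

  Upper bound. The maximum likelihood estimator maximises the norm of the signed sum of the observations. If
  it errs on a block of \<open>m\<close> labels, with \<open>m \<le> n / 2\<close> after a change of the global sign, then the sum of the
  observations with their labels removed over this block has a nonpositive inner product with the sum over the complement
  (\<open>error_block_of_better_fit\<close>). This inner product is a Gaussian chaos with an explicit exponential moment, and
  its probability to be nonpositive is at most \<open>exp (- m * r\<^sup>2 / 8)\<close> (\<open>prob_block_product_le\<close>). The
  number of blocks is at most \<open>(exp 1 * n / m) ^ m\<close>. Hence the union bound is effective once \<open>m / n\<close> exceeds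
  a multiple of \<open>exp (- r\<^sup>2 / 16)\<close>, and smaller blocks contribute only a term of that order to the risk
  (\<open>sum_large_blocks_le\<close>).
\<close>

section \<open>Integration over finite product spaces\<close>

text \<open>
  The noise is given as a family of columns, while the likelihoods and exponential moments below factor over
  the rows \<open>k\<close>. Integrating out one column is a product integral over \<open>K\<close>, and what remains is again a
  product over the rows (with factors \<open>F k\<close>), so that induction on the columns applies.
\<close>

lemma nn_integral_PiM_PiM_transpose:
  fixes M :: "'i \<Rightarrow> 'k \<Rightarrow> 'a measure" and f :: "'k \<Rightarrow> ('i \<Rightarrow> 'a) \<Rightarrow> ennreal"
  assumes sf: "\<And>i k. sigma_finite_measure (M i k)"
    and "finite I" "finite K"
    and "\<And>k. k \<in> K \<Longrightarrow> f k \<in> borel_measurable (\<Pi>\<^sub>M i\<in>I. M i k)"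
  shows "(\<integral>\<^sup>+x. (\<Prod>k\<in>K. f k (\<lambda>i\<in>I. x i k)) \<partial>(\<Pi>\<^sub>M i\<in>I. \<Pi>\<^sub>M k\<in>K. M i k))
    = (\<Prod>k\<in>K. \<integral>\<^sup>+x. f k x \<partial>(\<Pi>\<^sub>M i\<in>I. M i k))"
  using assms(2,4)
proof (induction I arbitrary: f)
  case empty
  then show ?case by (simp add: PiM_empty nn_integral_count_space_finite restrict_def)
next
  case (insert i I)
  note insert.prems[measurable]
  interpret rows: product_sigma_finite "M j" for j by unfold_locales (metis sf sigma_finite_measure_def)+
  interpret cols: product_sigma_finite "\<lambda>j. M j k" for k
    by unfold_locales (metis sf sigma_finite_measure_def)+
  interpret product_sigma_finite "\<lambda>i. \<Pi>\<^sub>M k\<in>K. M i k"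
    unfolding product_sigma_finite_def using rows.sigma_finite[OF \<open>finite K\<close>] by simp
  define F where "F k x = (\<integral>\<^sup>+y. f k (x(i := y)) \<partial>M i k)" for k x
  have [measurable]: "F k \<in> borel_measurable (\<Pi>\<^sub>M i\<in>I. M i k)" if [measurable]: "k \<in> K" for k
  proof -
    have "(\<lambda>(x, y). f k (x(i := y))) \<in> borel_measurable ((\<Pi>\<^sub>M i\<in>I. M i k) \<Otimes>\<^sub>M M i k)"
      using measurable_compose[OF measurable_add_dim insert.prems[OF that]]
      by (simp add: case_prod_beta' fun_upd_def)
    then show ?thesis unfolding F_def by (rule sigma_finite_measure.borel_measurable_nn_integral[OF sf])
  qed
  have [measurable]: "(\<lambda>x. x j k) \<in> (\<Pi>\<^sub>M i\<in>insert i I. \<Pi>\<^sub>M k\<in>K. M i k) \<rightarrow>\<^sub>M M j k"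
    if "j \<in> insert i I" "k \<in> K" for j k
    using that
    by (intro measurable_compose[OF measurable_component_singleton[of j] measurable_component_singleton[of k]])
  have upd: "(\<lambda>j\<in>insert i I. (X(i := y)) j k) = (\<lambda>j\<in>I. X j k)(i := y k)" for X y k
    using insert.hyps by (auto simp: fun_eq_iff)
  have "(\<integral>\<^sup>+x. (\<Prod>k\<in>K. f k (\<lambda>j\<in>insert i I. x j k)) \<partial>(\<Pi>\<^sub>M i\<in>insert i I. \<Pi>\<^sub>M k\<in>K. M i k))
      = (\<integral>\<^sup>+X. (\<integral>\<^sup>+y. (\<Prod>k\<in>K. f k (\<lambda>j\<in>insert i I. (X(i := y)) j k)) \<partial>(\<Pi>\<^sub>M k\<in>K. M i k))
          \<partial>(\<Pi>\<^sub>M i\<in>I. \<Pi>\<^sub>M k\<in>K. M i k))"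
    using insert.hyps by (intro product_nn_integral_insert) measurable
  also have "\<dots> = (\<integral>\<^sup>+X. (\<Prod>k\<in>K. F k (\<lambda>j\<in>I. X j k)) \<partial>(\<Pi>\<^sub>M i\<in>I. \<Pi>\<^sub>M k\<in>K. M i k))"
  proof (rule nn_integral_cong)
    fix X assume X: "X \<in> space (\<Pi>\<^sub>M i\<in>I. \<Pi>\<^sub>M k\<in>K. M i k)"
    show "(\<integral>\<^sup>+y. (\<Prod>k\<in>K. f k (\<lambda>j\<in>insert i I. (X(i := y)) j k)) \<partial>(\<Pi>\<^sub>M k\<in>K. M i k))
        = (\<Prod>k\<in>K. F k (\<lambda>j\<in>I. X j k))"
      unfolding upd F_def
    proof (rule rows.product_nn_integral_prod[OF \<open>finite K\<close>])
      fix k assume k: "k \<in> K"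
      have "(\<lambda>j\<in>I. X j k) \<in> space (\<Pi>\<^sub>M i\<in>I. M i k)"
        using X k by (auto simp: space_PiM PiE_def Pi_def)
      from measurable_compose[OF measurable_component_update[OF this \<open>i \<notin> I\<close>] insert.prems[OF k]]
      show "(\<lambda>y. f k ((\<lambda>j\<in>I. X j k)(i := y))) \<in> borel_measurable (M i k)" .
    qed
  qed
  also have "\<dots> = (\<Prod>k\<in>K. \<integral>\<^sup>+x. F k x \<partial>(\<Pi>\<^sub>M i\<in>I. M i k))"
    by (rule insert.IH) measurable
  also have "\<dots> = (\<Prod>k\<in>K. \<integral>\<^sup>+x. f k x \<partial>(\<Pi>\<^sub>M i\<in>insert i I. M i k))"
    unfolding F_def using insert.hyps insert.prems
    by (intro prod.cong refl cols.product_nn_integral_insert[symmetric]) auto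
  finally show ?case .
qed

text \<open>
  A change of measure that holds on each factor holds on the product. Comparing \<open>T\<close> with a second map \<open>S\<close>,
  and not only with the identity, makes the rule apply to its own conclusion: it is used once for the entries of a
  column and once for the columns, with \<open>S\<close> the multiplication by \<open>\<sigma>\<close>.
\<close>

lemma nn_integral_PiM_change:
  fixes M :: "'i \<Rightarrow> 'a measure" and N :: "'i \<Rightarrow> 'b measure"
  assumes "product_sigma_finite M" and "finite I"
    and T: "\<And>i. i \<in> I \<Longrightarrow> T i \<in> M i \<rightarrow>\<^sub>M N i"
    and S: "\<And>i. i \<in> I \<Longrightarrow> S i \<in> M i \<rightarrow>\<^sub>M N i"
    and h: "\<And>i. i \<in> I \<Longrightarrow> h i \<in> borel_measurable (M i)"
    and change: "\<And>i f. i \<in> I \<Longrightarrow> f \<in> borel_measurable (N i) \<Longrightarrow>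
      (\<integral>\<^sup>+x. f (T i x) \<partial>M i) = (\<integral>\<^sup>+x. f (S i x) * h i x \<partial>M i)"
    and "f \<in> borel_measurable (Pi\<^sub>M I N)"
  shows "(\<integral>\<^sup>+x. f (\<lambda>i\<in>I. T i (x i)) \<partial>Pi\<^sub>M I M)
    = (\<integral>\<^sup>+x. f (\<lambda>i\<in>I. S i (x i)) * (\<Prod>i\<in>I. h i (x i)) \<partial>Pi\<^sub>M I M)"
  using assms(2-)
proof (induction I arbitrary: f)
  case empty
  then show ?case by simp
next
  case (insert i I)
  interpret product_sigma_finite M by fact
  interpret sigma_finite_measure "M i" by (rule sigma_finite_measures)
  have f[measurable]: "f \<in> borel_measurable (Pi\<^sub>M (insert i I) N)" by (rule insert.prems)
  have [measurable]: "T j \<in> M j \<rightarrow>\<^sub>M N j" "S j \<in> M j \<rightarrow>\<^sub>M N j" "h j \<in> borel_measurable (M j)"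
    if "j \<in> insert i I" for j
    using insert.prems that by auto
  have [measurable]: "S i \<in> M i \<rightarrow>\<^sub>M N i" "T i \<in> M i \<rightarrow>\<^sub>M N i" "h i \<in> borel_measurable (M i)"
    using insert.prems by auto
  define G where "G u = (\<integral>\<^sup>+y. f (u(i := S i y)) * h i y \<partial>M i)" for u
  have f_upd[measurable]: "(\<lambda>(u, z). f (u(i := z))) \<in> borel_measurable (Pi\<^sub>M I N \<Otimes>\<^sub>M N i)"
    using measurable_compose[OF measurable_add_dim f] by (simp add: case_prod_beta' fun_upd_def)
  have "(\<lambda>(u, y). f (u(i := S i y)) * h i y) \<in> borel_measurable (Pi\<^sub>M I N \<Otimes>\<^sub>M M i)"
    by measurable
  then have [measurable]: "G \<in> borel_measurable (Pi\<^sub>M I N)"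
    unfolding G_def by (rule borel_measurable_nn_integral)
  have upd: "(\<lambda>j\<in>insert i I. R j ((X(i := y)) j)) = (\<lambda>j\<in>I. R j (X j))(i := R i y)"
    for R :: "'i \<Rightarrow> 'a \<Rightarrow> 'b" and X y
    using insert.hyps by (auto simp: fun_eq_iff)
  have prod_upd: "(\<Prod>j\<in>insert i I. h j ((X(i := y)) j)) = h i y * (\<Prod>j\<in>I. h j (X j))" for X y
    using insert.hyps by (auto intro!: arg_cong2[where f="(*)"] prod.cong)
  have "(\<integral>\<^sup>+x. f (\<lambda>j\<in>insert i I. T j (x j)) \<partial>Pi\<^sub>M (insert i I) M)
      = (\<integral>\<^sup>+X. (\<integral>\<^sup>+y. f ((\<lambda>j\<in>I. T j (X j))(i := T i y)) \<partial>M i) \<partial>Pi\<^sub>M I M)"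
    unfolding upd[symmetric] using insert.hyps by (intro product_nn_integral_insert) measurable
  also have "\<dots> = (\<integral>\<^sup>+X. G (\<lambda>j\<in>I. T j (X j)) \<partial>Pi\<^sub>M I M)"
  proof (rule nn_integral_cong)
    fix X assume [measurable]: "X \<in> space (Pi\<^sub>M I M)"
    have "(\<lambda>j\<in>I. T j (X j)) \<in> space (Pi\<^sub>M I N)"
      by (rule measurable_space[of "\<lambda>X. \<lambda>j\<in>I. T j (X j)" "Pi\<^sub>M I M"]) measurable
    from measurable_compose[OF measurable_component_update[OF this] f]
    have "(\<lambda>z. f ((\<lambda>j\<in>I. T j (X j))(i := z))) \<in> borel_measurable (N i)"
      using insert.hyps by simp
    from insert.prems(4)[OF _ this]
    show "(\<integral>\<^sup>+y. f ((\<lambda>j\<in>I. T j (X j))(i := T i y)) \<partial>M i) = G (\<lambda>j\<in>I. T j (X j))"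
      unfolding G_def by simp
  qed
  also have "\<dots> = (\<integral>\<^sup>+X. G (\<lambda>j\<in>I. S j (X j)) * (\<Prod>j\<in>I. h j (X j)) \<partial>Pi\<^sub>M I M)"
    using insert.prems by (intro insert.IH) auto
  also have "\<dots> = (\<integral>\<^sup>+X. (\<integral>\<^sup>+y. f ((\<lambda>j\<in>I. S j (X j))(i := S i y)) * (h i y * (\<Prod>j\<in>I. h j (X j))) \<partial>M i)
      \<partial>Pi\<^sub>M I M)"
  proof (rule nn_integral_cong)
    fix X assume [measurable]: "X \<in> space (Pi\<^sub>M I M)"
    have sp: "(\<lambda>j\<in>I. S j (X j)) \<in> space (Pi\<^sub>M I N)"
      by (rule measurable_space[of "\<lambda>X. \<lambda>j\<in>I. S j (X j)" "Pi\<^sub>M I M"]) measurable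
    have [measurable]: "(\<lambda>z. f ((\<lambda>j\<in>I. S j (X j))(i := z))) \<in> borel_measurable (N i)"
      using measurable_compose[OF measurable_component_update[OF sp] f] insert.hyps by simp
    show "G (\<lambda>j\<in>I. S j (X j)) * (\<Prod>j\<in>I. h j (X j))
        = (\<integral>\<^sup>+y. f ((\<lambda>j\<in>I. S j (X j))(i := S i y)) * (h i y * (\<Prod>j\<in>I. h j (X j))) \<partial>M i)"
      unfolding G_def mult.assoc[symmetric] by (rule nn_integral_multc[symmetric]) measurable
  qed
  also have "\<dots> = (\<integral>\<^sup>+x. f (\<lambda>j\<in>insert i I. S j (x j)) * (\<Prod>j\<in>insert i I. h j (x j)) \<partial>Pi\<^sub>M (insert i I) M)"
    unfolding upd[symmetric] prod_upd[symmetric]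
    using insert.hyps by (intro product_nn_integral_insert[symmetric]) measurable
  finally show ?case .
qed

section \<open>Gaussian integrals\<close>

abbreviation "\<gamma> \<equiv> std_normal_distribution"

lemma prob_space_std_normal: "prob_space \<gamma>"
  by (rule prob_space_normal_density) simp

lemma product_sigma_finite_std_normal: "product_sigma_finite (\<lambda>_. \<gamma>)"
  by (simp add: product_sigma_finite_def prob_space_imp_sigma_finite prob_space_std_normal)

text \<open>
  The one-dimensional Cameron-Martin formula.
\<close>

lemma nn_integral_std_normal_shift:
  assumes [measurable]: "g \<in> borel_measurable borel"
  shows "(\<integral>\<^sup>+x. g (x + b) \<partial>\<gamma>) = (\<integral>\<^sup>+x. g x * ennreal (exp (b * x - b\<^sup>2 / 2)) \<partial>\<gamma>)"
proof -
  have "(\<integral>\<^sup>+x. g x * ennreal (exp (b * x - b\<^sup>2 / 2)) \<partial>\<gamma>)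
      = (\<integral>\<^sup>+x. ennreal (std_normal_density x) * (g x * ennreal (exp (b * x - b\<^sup>2 / 2))) \<partial>lborel)"
    by (subst nn_integral_density) auto
  also have "\<dots> = (\<integral>\<^sup>+x. ennreal (std_normal_density (x - b)) * g x \<partial>lborel)"
  proof (rule nn_integral_cong)
    fix x
    have "std_normal_density x * exp (b * x - b\<^sup>2 / 2) = std_normal_density (x - b)"
      unfolding std_normal_density_def by (simp add: exp_add[symmetric] power2_eq_square field_simps)
    from arg_cong[OF this, of ennreal]
    show "ennreal (std_normal_density x) * (g x * ennreal (exp (b * x - b\<^sup>2 / 2)))
        = ennreal (std_normal_density (x - b)) * g x"
      by (simp add: ennreal_mult mult_ac)
  qed
  also have "\<dots> = (\<integral>\<^sup>+x. ennreal (std_normal_density x) * g (x + b) \<partial>lborel)"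
    by (subst nn_integral_real_affine[where c=1 and t=b]) (auto simp: add.commute)
  also have "\<dots> = (\<integral>\<^sup>+x. g (x + b) \<partial>\<gamma>)"
    by (subst nn_integral_density) auto
  finally show ?thesis ..
qed

lemma nn_integral_std_normal_exp: "(\<integral>\<^sup>+x. ennreal (exp (c * x)) \<partial>\<gamma>) = ennreal (exp (c\<^sup>2 / 2))"
proof -
  interpret prob_space \<gamma> by (rule prob_space_std_normal)
  have "(\<integral>\<^sup>+x. ennreal (exp (c * x)) \<partial>\<gamma>)
      = (\<integral>\<^sup>+x. ennreal (exp (c\<^sup>2 / 2)) * (1 * ennreal (exp (c * x - c\<^sup>2 / 2))) \<partial>\<gamma>)"
    by (intro nn_integral_cong) (simp add: ennreal_mult[symmetric] exp_add[symmetric])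
  also have "\<dots> = ennreal (exp (c\<^sup>2 / 2)) * (\<integral>\<^sup>+x. 1 * ennreal (exp (c * x - c\<^sup>2 / 2)) \<partial>\<gamma>)"
    by (rule nn_integral_cmult) simp
  also have "\<dots> = ennreal (exp (c\<^sup>2 / 2))"
    by (subst nn_integral_std_normal_shift[symmetric]) (simp_all add: emeasure_space_1[simplified])
  finally show ?thesis .
qed

lemma nn_integral_PiM_std_normal_exp:
  assumes "finite I"
  shows "(\<integral>\<^sup>+x. ennreal (exp (\<Sum>i\<in>I. c i * x i)) \<partial>(\<Pi>\<^sub>M i\<in>I. \<gamma>)) = ennreal (exp ((\<Sum>i\<in>I. (c i)\<^sup>2) / 2))"
proof -
  interpret product_sigma_finite "\<lambda>_. \<gamma>" by (rule product_sigma_finite_std_normal)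
  have "(\<integral>\<^sup>+x. (\<Prod>i\<in>I. ennreal (exp (c i * x i))) \<partial>(\<Pi>\<^sub>M i\<in>I. \<gamma>))
      = (\<Prod>i\<in>I. \<integral>\<^sup>+x. ennreal (exp (c i * x)) \<partial>\<gamma>)"
    using assms by (intro product_nn_integral_prod) auto
  with assms show ?thesis
    by (simp add: nn_integral_std_normal_exp prod_ennreal exp_sum[symmetric] sum_divide_distrib)
qed

lemma
  assumes "finite I"
  shows integrable_PiM_std_normal_exp: "integrable (\<Pi>\<^sub>M i\<in>I. \<gamma>) (\<lambda>x. exp (\<Sum>i\<in>I. c i * x i))"
    and integral_PiM_std_normal_exp:
      "(\<integral>x. exp (\<Sum>i\<in>I. c i * x i) \<partial>(\<Pi>\<^sub>M i\<in>I. \<gamma>)) = exp ((\<Sum>i\<in>I. (c i)\<^sup>2) / 2)"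
proof -
  have "(\<lambda>x. exp (\<Sum>i\<in>I. c i * x i)) \<in> borel_measurable (\<Pi>\<^sub>M i\<in>I. \<gamma>)" by measurable
  with nn_integral_PiM_std_normal_exp[OF assms, of c]
  have "integrable (\<Pi>\<^sub>M i\<in>I. \<gamma>) (\<lambda>x. exp (\<Sum>i\<in>I. c i * x i))
     \<and> (\<integral>x. exp (\<Sum>i\<in>I. c i * x i) \<partial>(\<Pi>\<^sub>M i\<in>I. \<gamma>)) = exp ((\<Sum>i\<in>I. (c i)\<^sup>2) / 2)"
    by (subst (asm) nn_integral_eq_integrable) auto
  then show "integrable (\<Pi>\<^sub>M i\<in>I. \<gamma>) (\<lambda>x. exp (\<Sum>i\<in>I. c i * x i))"
    "(\<integral>x. exp (\<Sum>i\<in>I. c i * x i) \<partial>(\<Pi>\<^sub>M i\<in>I. \<gamma>)) = exp ((\<Sum>i\<in>I. (c i)\<^sup>2) / 2)"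
    by auto
qed

text \<open>
  Completing the square turns the integrand, times the standard density, into a multiple of the normal density
  with mean \<open>\<alpha> / (1 - \<beta>)\<close> and variance \<open>1 / (1 - \<beta>)\<close>.
\<close>

lemma nn_integral_std_normal_exp_quadratic:
  assumes "\<beta> < 1"
  shows "(\<integral>\<^sup>+z. ennreal (exp (\<alpha> * z + \<beta> * z\<^sup>2 / 2)) \<partial>\<gamma>)
    = ennreal (exp (\<alpha>\<^sup>2 / (2 * (1 - \<beta>))) / sqrt (1 - \<beta>))"
proof -
  define C where "C = exp (\<alpha>\<^sup>2 / (2 * (1 - \<beta>))) / sqrt (1 - \<beta>)"
  define \<mu> where "\<mu> = \<alpha> / (1 - \<beta>)"
  define \<tau> where "\<tau> = 1 / sqrt (1 - \<beta>)"
  have [simp]: "\<tau> > 0" "C \<ge> 0" using assms by (auto simp: \<tau>_def C_def)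
  have \<tau>2: "\<tau>\<^sup>2 = 1 / (1 - \<beta>)" using assms by (simp add: \<tau>_def power_divide)
  have eq: "std_normal_density z * exp (\<alpha> * z + \<beta> * z\<^sup>2 / 2) = C * normal_density \<mu> \<tau> z" for z
  proof -
    have "sqrt (2 * pi * \<tau>\<^sup>2) = sqrt (2 * pi) * \<tau>"
      using \<open>\<tau> > 0\<close> by (simp add: real_sqrt_mult abs_of_pos)
    moreover have "- z\<^sup>2 / 2 + (\<alpha> * z + \<beta> * z\<^sup>2 / 2)
        = \<alpha>\<^sup>2 / (2 * (1 - \<beta>)) + - (z - \<mu>)\<^sup>2 / (2 * \<tau>\<^sup>2)"
      using assms unfolding \<tau>2 \<mu>_def by (simp add: divide_simps) algebra
    ultimately show ?thesis
      unfolding normal_density_def C_def std_normal_density_def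
      using assms by (simp add: exp_add[symmetric] \<tau>_def)
  qed
  have "(\<integral>\<^sup>+z. ennreal (exp (\<alpha> * z + \<beta> * z\<^sup>2 / 2)) \<partial>\<gamma>)
      = (\<integral>\<^sup>+z. ennreal (C * normal_density \<mu> \<tau> z) \<partial>lborel)"
    by (subst nn_integral_density) (auto simp: ennreal_mult[symmetric] eq simp del: ennreal_mult)
  also have "\<dots> = ennreal (\<integral>z. C * normal_density \<mu> \<tau> z \<partial>lborel)"
    by (rule nn_integral_eq_integral) auto
  finally show ?thesis by (simp add: C_def)
qed

text \<open>
  The exponential moment of the product of two independent Gaussian sums. Given the sum \<open>U\<close> over \<open>I - T\<close>, the
  exponent is linear in the variables of the block \<open>T\<close>, and integrating these out leaves
  \<open>exp (b * U + c * U\<^sup>2 / 2)\<close>. The square is linearised by an auxiliary standard Gaussian \<open>z\<close>, as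
  \<open>exp (c * U\<^sup>2 / 2)\<close> is the mean of \<open>exp (sqrt c * z * U)\<close>; then the variables in \<open>I - T\<close> are integrated out
  in the same way, and a one-dimensional Gaussian integral in \<open>z\<close> remains.
\<close>

lemma nn_integral_exp_product_of_sums:
  fixes e :: "'i \<Rightarrow> real" and l t :: real
  assumes "finite I" "T \<subseteq> I" and e: "\<And>i. i \<in> I \<Longrightarrow> e i \<in> {-1, 1}"
    and l: "0 \<le> l" "l\<^sup>2 * card T * card (I - T) < 1"
  defines "m \<equiv> real (card T)" and "N \<equiv> real (card (I - T))"
  defines "\<beta> \<equiv> l\<^sup>2 * m * N"
  defines "\<kappa> \<equiv> N\<^sup>2 * m * (l * t * (1 - l * m))\<^sup>2"
  shows "(\<integral>\<^sup>+x. ennreal (exp (- l * ((\<Sum>i\<in>I - T. t + e i * x i) * (\<Sum>i\<in>T. t + e i * x i)))) \<partial>(\<Pi>\<^sub>M i\<in>I. \<gamma>))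
    = ennreal (exp (- l * m * N * t\<^sup>2 + l\<^sup>2 * m\<^sup>2 * N * t\<^sup>2 / 2 + \<kappa> / (2 * (1 - \<beta>))) / sqrt (1 - \<beta>))"
proof -
  interpret product_sigma_finite "\<lambda>_. \<gamma>" by (rule product_sigma_finite_std_normal)
  have fin: "finite T" "finite (I - T)" and un: "(I - T) \<union> T = I"
    using assms finite_subset by auto
  interpret A: finite_product_sigma_finite "\<lambda>_. \<gamma>" "I - T" by unfold_locales fact
  have e2: "(e i)\<^sup>2 = 1" if "i \<in> I" for i using e[OF that] by auto
  define b where "b = - l * m * t"
  define c where "c = l\<^sup>2 * m"
  have c0: "c \<ge> 0" by (simp add: c_def m_def)
  define U where "U x = (\<Sum>i\<in>I - T. t + e i * x i)" for x
  have [measurable]: "U \<in> borel_measurable (\<Pi>\<^sub>M i\<in>I - T. \<gamma>)" unfolding U_def by measurable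
  have lin: "(\<integral>\<^sup>+x. ennreal (exp (s * (\<Sum>i\<in>J. t + e i * x i))) \<partial>(\<Pi>\<^sub>M i\<in>J. \<gamma>))
      = ennreal (exp (s * card J * t + s\<^sup>2 * card J / 2))" if J: "finite J" "J \<subseteq> I" for J s
  proof -
    have "(\<integral>\<^sup>+x. ennreal (exp (s * (\<Sum>i\<in>J. t + e i * x i))) \<partial>(\<Pi>\<^sub>M i\<in>J. \<gamma>))
        = (\<integral>\<^sup>+x. ennreal (exp (s * card J * t)) * ennreal (exp (\<Sum>i\<in>J. (s * e i) * x i)) \<partial>(\<Pi>\<^sub>M i\<in>J. \<gamma>))"
      by (intro nn_integral_cong)
         (simp add: ennreal_mult[symmetric] exp_add[symmetric] sum.distrib sum_distrib_left algebra_simps)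
    also have "\<dots> = ennreal (exp (s * card J * t)) * ennreal (exp ((\<Sum>i\<in>J. (s * e i)\<^sup>2) / 2))"
      by (subst nn_integral_cmult) (auto simp: nn_integral_PiM_std_normal_exp J)
    also have "(\<Sum>i\<in>J. (s * e i)\<^sup>2) = s\<^sup>2 * card J"
      using J by (simp add: power_mult_distrib subset_iff e2)
    finally show ?thesis by (simp add: ennreal_mult[symmetric] exp_add[symmetric])
  qed
  have "(\<integral>\<^sup>+x. ennreal (exp (- l * ((\<Sum>i\<in>I - T. t + e i * x i) * (\<Sum>i\<in>T. t + e i * x i)))) \<partial>(\<Pi>\<^sub>M i\<in>I. \<gamma>))
     = (\<integral>\<^sup>+x. (\<integral>\<^sup>+y. ennreal (exp (- l * ((\<Sum>i\<in>I - T. t + e i * merge (I - T) T (x, y) i)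
            * (\<Sum>i\<in>T. t + e i * merge (I - T) T (x, y) i)))) \<partial>(\<Pi>\<^sub>M i\<in>T. \<gamma>)) \<partial>(\<Pi>\<^sub>M i\<in>I - T. \<gamma>))"
    using product_nn_integral_fold[of "I - T" T
       "\<lambda>x. ennreal (exp (- l * ((\<Sum>i\<in>I - T. t + e i * x i) * (\<Sum>i\<in>T. t + e i * x i))))"] fin
    unfolding un using assms(2) by (auto simp: subset_iff)
  also have "\<dots> = (\<integral>\<^sup>+x. (\<integral>\<^sup>+y. ennreal (exp (- l * U x * (\<Sum>i\<in>T. t + e i * y i))) \<partial>(\<Pi>\<^sub>M i\<in>T. \<gamma>))
      \<partial>(\<Pi>\<^sub>M i\<in>I - T. \<gamma>))"
    unfolding U_def
    by (intro nn_integral_cong arg_cong[where f="\<lambda>u. ennreal (exp u)"]) (simp add: mult.assoc)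
  also have "\<dots> = (\<integral>\<^sup>+x. ennreal (exp (b * U x + c * (U x)\<^sup>2 / 2)) \<partial>(\<Pi>\<^sub>M i\<in>I - T. \<gamma>))"
    using fin assms(2)
    by (subst lin) (auto simp: b_def c_def m_def power_mult_distrib mult_ac)
  also have "\<dots> = (\<integral>\<^sup>+x. (\<integral>\<^sup>+z. ennreal (exp ((b + sqrt c * z) * U x)) \<partial>\<gamma>) \<partial>(\<Pi>\<^sub>M i\<in>I - T. \<gamma>))"
  proof (rule nn_integral_cong)
    fix x
    have "(\<integral>\<^sup>+z. ennreal (exp ((b + sqrt c * z) * U x)) \<partial>\<gamma>)
        = (\<integral>\<^sup>+z. ennreal (exp (b * U x)) * ennreal (exp ((sqrt c * U x) * z)) \<partial>\<gamma>)"
      by (intro nn_integral_cong)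
         (simp add: ennreal_mult[symmetric] exp_add[symmetric] algebra_simps)
    also have "\<dots> = ennreal (exp (b * U x)) * ennreal (exp ((sqrt c * U x)\<^sup>2 / 2))"
      by (subst nn_integral_cmult) (auto simp: nn_integral_std_normal_exp)
    finally show "ennreal (exp (b * U x + c * (U x)\<^sup>2 / 2))
        = (\<integral>\<^sup>+z. ennreal (exp ((b + sqrt c * z) * U x)) \<partial>\<gamma>)"
      using c0 by (simp add: ennreal_mult[symmetric] exp_add[symmetric] power_mult_distrib)
  qed
  also have "\<dots> = (\<integral>\<^sup>+z. (\<integral>\<^sup>+x. ennreal (exp ((b + sqrt c * z) * U x)) \<partial>(\<Pi>\<^sub>M i\<in>I - T. \<gamma>)) \<partial>\<gamma>)"
  proof (rule pair_sigma_finite.Fubini')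
    show "pair_sigma_finite \<gamma> (\<Pi>\<^sub>M i\<in>I - T. \<gamma>)"
      by (simp add: pair_sigma_finite_def A.sigma_finite_measure_axioms sigma_finite_measures)
  qed measurable
  also have "\<dots> = (\<integral>\<^sup>+z. ennreal (exp (b * N * t + N * b\<^sup>2 / 2))
      * ennreal (exp ((sqrt c * N * (t + b)) * z + \<beta> * z\<^sup>2 / 2)) \<partial>\<gamma>)"
  proof (rule nn_integral_cong)
    fix z
    have \<beta>c: "\<beta> = N * c" by (simp add: \<beta>_def c_def)
    have "(b + sqrt c * z) * N * t + (b + sqrt c * z)\<^sup>2 * N / 2
       = (b * N * t + N * b\<^sup>2 / 2) + (sqrt c * N * (t + b) * z + \<beta> * z\<^sup>2 / 2)"
      using c0 by (simp add: \<beta>c power2_sum power_mult_distrib algebra_simps add_divide_distrib)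
    then show "(\<integral>\<^sup>+x. ennreal (exp ((b + sqrt c * z) * U x)) \<partial>(\<Pi>\<^sub>M i\<in>I - T. \<gamma>))
       = ennreal (exp (b * N * t + N * b\<^sup>2 / 2)) * ennreal (exp ((sqrt c * N * (t + b)) * z + \<beta> * z\<^sup>2 / 2))"
      unfolding U_def using fin
      by (simp add: lin N_def[symmetric] ennreal_mult[symmetric] exp_add[symmetric])
  qed
  also have "\<dots> = ennreal (exp (b * N * t + N * b\<^sup>2 / 2)) *
       ennreal (exp ((sqrt c * N * (t + b))\<^sup>2 / (2 * (1 - \<beta>))) / sqrt (1 - \<beta>))"
    using l(2) by (subst nn_integral_cmult)
      (auto simp: nn_integral_std_normal_exp_quadratic \<beta>_def m_def N_def)
  also have "\<dots> = ennreal (exp (b * N * t + N * b\<^sup>2 / 2 + (sqrt c * N * (t + b))\<^sup>2 / (2 * (1 - \<beta>))) / sqrt (1 - \<beta>))"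
    by (simp add: ennreal_mult'[symmetric] exp_add)
  also have "b * N * t + N * b\<^sup>2 / 2 = - l * m * N * t\<^sup>2 + l\<^sup>2 * m\<^sup>2 * N * t\<^sup>2 / 2"
    by (simp add: b_def power2_eq_square)
  also have "(sqrt c * N * (t + b))\<^sup>2 = \<kappa>"
    using c0 by (simp add: power_mult_distrib) (simp add: c_def \<kappa>_def b_def power2_eq_square algebra_simps)
  finally show ?thesis .
qed

section \<open>The Hellinger affinity of one coordinate\<close>

lemma
  assumes "finite I"
  shows integrable_PiM_std_normal_cosh:
      "integrable (\<Pi>\<^sub>M i\<in>I. \<gamma>) (\<lambda>x. cosh (\<Sum>i\<in>I. c i * x i))"
    and integral_PiM_std_normal_cosh:
      "(\<integral>x. cosh (\<Sum>i\<in>I. c i * x i) \<partial>(\<Pi>\<^sub>M i\<in>I. \<gamma>)) = exp ((\<Sum>i\<in>I. (c i)\<^sup>2) / 2)"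
proof -
  have cosh_eq: "cosh (\<Sum>i\<in>I. c i * x i) = (exp (\<Sum>i\<in>I. c i * x i) + exp (\<Sum>i\<in>I. (- c i) * x i)) / 2"
    for x :: "'a \<Rightarrow> real"
    by (simp add: cosh_def sum_negf)
  note int = integrable_PiM_std_normal_exp[OF assms]
  show "integrable (\<Pi>\<^sub>M i\<in>I. \<gamma>) (\<lambda>x. cosh (\<Sum>i\<in>I. c i * x i))"
    unfolding cosh_eq by (intro integrable_divide_zero Bochner_Integration.integrable_add int)
  show "(\<integral>x. cosh (\<Sum>i\<in>I. c i * x i) \<partial>(\<Pi>\<^sub>M i\<in>I. \<gamma>)) = exp ((\<Sum>i\<in>I. (c i)\<^sup>2) / 2)"
    unfolding cosh_eq
    by (simp only: integral_divide_zero Bochner_Integration.integral_add[OF int int]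
          integral_PiM_std_normal_exp[OF assms]) simp
qed

text \<open>
  Writing \<open>cosh (a + b) * cosh (a - b)\<close> as a difference of squares \<open>X\<^sup>2 - Y\<^sup>2\<close> shows that its root is at least
  \<open>X - Y\<^sup>2 / X = cosh a * cosh b - (cosh a - 1 / cosh a) * (cosh b - 1 / cosh b)\<close>. The means of the
  terms \<open>1 / cosh\<close> under a Gaussian law have no closed form, so \<open>1 / u\<close> is replaced by its tangent at \<open>u = A\<close>,
  respectively \<open>u = B\<close>. Only means of hyperbolic cosines are then needed, and the tangent loses nothing against
  Jensen's inequality when \<open>A\<close> and \<open>B\<close> are the means of \<open>cosh a\<close> and \<open>cosh b\<close>.
\<close>

lemma sqrt_cosh_mult_ge:
  fixes a b A B :: real
  assumes "A > 0" "B > 0"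
  shows "cosh a * cosh b - (cosh a * (1 + 1 / A\<^sup>2) - 2 / A) * (cosh b * (1 + 1 / B\<^sup>2) - 2 / B)
    \<le> sqrt (cosh (a + b) * cosh (a - b))"
proof -
  define X Y where "X = cosh a * cosh b" and "Y = sinh a * sinh b"
  have X: "X > 0" by (simp add: X_def)
  have tangent: "cosh u - 1 / cosh u \<le> cosh u * (1 + 1 / C\<^sup>2) - 2 / C" if "C > 0" for u C :: real
  proof -
    have "0 \<le> (1 - cosh u / C)\<^sup>2 / cosh u" by (intro divide_nonneg_pos) auto
    also have "(1 - cosh u / C)\<^sup>2 / cosh u = 1 / cosh u - 2 / C + cosh u / C\<^sup>2"
      using that by (simp add: power2_eq_square field_simps)
    finally show ?thesis by (simp add: algebra_simps)
  qed
  have defect: "cosh u - 1 / cosh u = (sinh u)\<^sup>2 / cosh u" for u :: real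
    using cosh_square_eq[of u] by (simp add: field_simps power2_eq_square)
  have "Y\<^sup>2 \<le> X\<^sup>2"
    unfolding X_def Y_def power_mult_distrib
    by (intro mult_mono) (auto simp: cosh_square_eq)
  then have Y4: "Y\<^sup>2 * Y\<^sup>2 \<le> X\<^sup>2 * Y\<^sup>2" by (intro mult_right_mono) auto
  have "X - Y\<^sup>2 / X \<le> sqrt (X\<^sup>2 - Y\<^sup>2)"
  proof (rule real_le_rsqrt)
    have "(X - Y\<^sup>2 / X)\<^sup>2 = X\<^sup>2 - 2 * Y\<^sup>2 + Y\<^sup>2 * Y\<^sup>2 / X\<^sup>2"
      using X by (simp add: power2_diff power_divide)
    also have "Y\<^sup>2 * Y\<^sup>2 / X\<^sup>2 \<le> Y\<^sup>2"
      using Y4 X by (simp add: divide_le_eq mult.commute)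
    finally show "(X - Y\<^sup>2 / X)\<^sup>2 \<le> X\<^sup>2 - Y\<^sup>2" by simp
  qed
  also have "X\<^sup>2 - Y\<^sup>2 = cosh (a + b) * cosh (a - b)"
    by (simp add: X_def Y_def cosh_add cosh_diff power2_eq_square algebra_simps)
  also have "Y\<^sup>2 / X = (cosh a - 1 / cosh a) * (cosh b - 1 / cosh b)"
    unfolding defect by (simp add: X_def Y_def power_mult_distrib)
  finally have "X - (cosh a - 1 / cosh a) * (cosh b - 1 / cosh b) \<le> sqrt (cosh (a + b) * cosh (a - b))" .
  moreover have "(cosh a - 1 / cosh a) * (cosh b - 1 / cosh b)
      \<le> (cosh a * (1 + 1 / A\<^sup>2) - 2 / A) * (cosh b * (1 + 1 / B\<^sup>2) - 2 / B)"
  proof (intro mult_mono tangent assms)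
    show "0 \<le> cosh b - 1 / cosh b" unfolding defect by simp
    show "0 \<le> cosh a * (1 + 1 / A\<^sup>2) - 2 / A"
      using tangent[OF assms(1), of a] unfolding defect by (meson cosh_real_nonneg divide_nonneg_nonneg order_trans zero_le_power2)
  qed
  ultimately show ?thesis by (simp add: X_def)
qed

lemma exp_convex_combination:
  fixes w d :: real
  assumes "0 \<le> w" "w \<le> 1"
  shows "exp (- (w * d)) \<le> 1 - w * (1 - exp (- d))"
  using convex_onD[OF exp_convex, of w 0 "- d"] assms by (simp add: algebra_simps)

text \<open>
  For a single coordinate of the observations, with \<open>\<theta>\<close> equal to \<open>\<delta>\<close> or \<open>- \<delta>\<close> with probability one half each,
  the integral is the Hellinger affinity between the laws for two label vectors that differ at \<open>j\<close> only. With the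
  means \<open>A\<close> and \<open>B\<close> of the two hyperbolic cosines it is at least
  \<open>1 - (1 - 1 / A\<^sup>2) * (1 - 1 / B\<^sup>2) = 1 - w * (1 - exp (- \<delta>\<^sup>2))\<close>, and convexity of \<open>exp\<close>
  gives the stated form. The factor \<open>w\<close> measures how well the other observations reveal the sign of \<open>\<theta>\<close>.
\<close>

lemma coordinate_affinity_ge:
  fixes e :: "'i \<Rightarrow> real" and \<delta> :: real
  assumes "finite I" "j \<in> I" and e: "\<And>i. i \<in> I \<Longrightarrow> e i \<in> {-1, 1}"
  defines "w \<equiv> 1 - exp (- (real (card I - 1) * \<delta>\<^sup>2))"
  shows "ennreal (exp (- (w * \<delta>\<^sup>2)))
    \<le> (\<integral>\<^sup>+x. ennreal (exp (- (card I * \<delta>\<^sup>2 / 2)) * sqrt (cosh (\<delta> * (\<Sum>i\<in>I. e i * x i))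
        * cosh (\<delta> * (\<Sum>i\<in>I. (e(j := - e j)) i * x i)))) \<partial>(\<Pi>\<^sub>M i\<in>I. \<gamma>))"
proof -
  define \<Gamma> where "\<Gamma> = (\<Pi>\<^sub>M i\<in>I. \<gamma>)"
  define A where "A = exp (real (card I - 1) * \<delta>\<^sup>2 / 2)"
  define B where "B = exp (\<delta>\<^sup>2 / 2)"
  have AB: "A > 0" "B > 0" by (auto simp: A_def B_def)
  have e2: "(e i)\<^sup>2 = 1" if "i \<in> I" for i using e[OF that] by auto
  have e2': "((e(j := - e j)) i)\<^sup>2 = 1" if "i \<in> I" for i using e2 that by auto
  have card: "real (card I) = real (card I - 1) + 1"
    using assms card_gt_0_iff[of I] by (auto simp: of_nat_diff)
  have ABprod: "A * B = exp (card I * \<delta>\<^sup>2 / 2)"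
    unfolding A_def B_def exp_add[symmetric] card by (simp add: field_simps)
  \<comment> \<open>The variable \<open>x j\<close> is separated from the others: \<open>s = a + b\<close> belongs to \<open>e\<close>, and \<open>d = a - b\<close>
    to \<open>e\<close> with the sign at \<open>j\<close> reversed.\<close>
  define a b s d where
    "a x = (\<Sum>i\<in>I. (if i = j then 0 else \<delta> * e i) * x i)"
    and "b x = (\<Sum>i\<in>I. (if i = j then \<delta> * e i else 0) * x i)"
    and "s x = (\<Sum>i\<in>I. (\<delta> * e i) * x i)"
    and "d x = (\<Sum>i\<in>I. (\<delta> * (e(j := - e j)) i) * x i)" for x
  have ab: "s x = a x + b x" "d x = a x - b x" for x
    unfolding a_def b_def s_def d_def sum.distrib[symmetric] sum_subtractf[symmetric]
    by (auto intro!: sum.cong)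
  have [measurable]: "a \<in> borel_measurable \<Gamma>" "b \<in> borel_measurable \<Gamma>"
    "s \<in> borel_measurable \<Gamma>" "d \<in> borel_measurable \<Gamma>"
    unfolding a_def b_def s_def d_def \<Gamma>_def by measurable
  have int: "integrable \<Gamma> (\<lambda>x. cosh (a x))" "integrable \<Gamma> (\<lambda>x. cosh (b x))"
    "integrable \<Gamma> (\<lambda>x. cosh (s x))" "integrable \<Gamma> (\<lambda>x. cosh (d x))"
    unfolding a_def b_def s_def d_def \<Gamma>_def using assms(1)
    by (rule integrable_PiM_std_normal_cosh)+
  have sumsq: "(\<Sum>i\<in>I. (if i = j then 0 else \<delta> * e i)\<^sup>2) = real (card I - 1) * \<delta>\<^sup>2"
  proof -
    have "(\<Sum>i\<in>I. (if i = j then 0 else \<delta> * e i)\<^sup>2) = (\<Sum>i\<in>I - {j}. \<delta>\<^sup>2)"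
      using assms by (intro sum.mono_neutral_cong_right) (auto simp: power_mult_distrib e2)
    then show ?thesis using assms by simp
  qed
  have sumsq': "(\<Sum>i\<in>I. (if i = j then \<delta> * e i else 0)\<^sup>2) = \<delta>\<^sup>2"
  proof -
    have "(\<Sum>i\<in>I. (if i = j then \<delta> * e i else 0)\<^sup>2) = (\<Sum>i\<in>{j}. \<delta>\<^sup>2)"
      using assms by (intro sum.mono_neutral_cong_right) (auto simp: power_mult_distrib e2)
    then show ?thesis by simp
  qed
  have I: "(\<integral>x. cosh (a x) \<partial>\<Gamma>) = A" "(\<integral>x. cosh (b x) \<partial>\<Gamma>) = B"
    "(\<integral>x. cosh (s x) \<partial>\<Gamma>) = A * B" "(\<integral>x. cosh (d x) \<partial>\<Gamma>) = A * B"
    unfolding a_def b_def s_def d_def \<Gamma>_def integral_PiM_std_normal_cosh[OF assms(1)] sumsq sumsq' ABprod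
    by (simp_all add: A_def B_def power_mult_distrib e2 e2' del: fun_upd_apply)
  \<comment> \<open>The lower bound for the root, expanded into hyperbolic cosines of linear forms.\<close>
  define g where "g x = (cosh (s x) + cosh (d x)) / 2 * (1 - (1 + 1 / A\<^sup>2) * (1 + 1 / B\<^sup>2))
      + 2 / B * (1 + 1 / A\<^sup>2) * cosh (a x) + 2 / A * (1 + 1 / B\<^sup>2) * cosh (b x) - 4 / (A * B)" for x
  define f where "f x = sqrt (cosh (s x) * cosh (d x))" for x
  have f_nonneg: "f x \<ge> 0" for x by (simp add: f_def)
  interpret \<Gamma>: prob_space \<Gamma>
    unfolding \<Gamma>_def by (intro prob_space_PiM prob_space_std_normal)
  have int_g: "integrable \<Gamma> g" unfolding g_def using int by simp
  have "g x \<le> f x" for x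
  proof -
    have cc: "(cosh (s x) + cosh (d x)) / 2 = cosh (a x) * cosh (b x)"
      by (simp add: ab cosh_add cosh_diff)
    have "g x = cosh (a x) * cosh (b x)
        - (cosh (a x) * (1 + 1 / A\<^sup>2) - 2 / A) * (cosh (b x) * (1 + 1 / B\<^sup>2) - 2 / B)"
      unfolding g_def cc using AB by (simp add: algebra_simps)
    with sqrt_cosh_mult_ge[OF AB, of "a x" "b x"] show ?thesis by (simp add: f_def ab)
  qed
  moreover have int_f: "integrable \<Gamma> f"
  proof (rule Bochner_Integration.integrable_bound)
    show "integrable \<Gamma> (\<lambda>x. cosh (s x) + cosh (d x))" using int by simp
    show "f \<in> borel_measurable \<Gamma>" unfolding f_def using int(3,4)[THEN borel_measurable_integrable] by measurable
    have "sqrt (u * v) \<le> u + v" if "u \<ge> 0" "v \<ge> 0" for u v :: real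
      using arith_geo_mean_sqrt[OF that] that by (auto simp: field_simps intro: order_trans)
    then show "AE x in \<Gamma>. norm (f x) \<le> norm (cosh (s x) + cosh (d x))"
      by (auto simp: f_def)
  qed
  ultimately have "(\<integral>x. g x \<partial>\<Gamma>) \<le> (\<integral>x. f x \<partial>\<Gamma>)"
    using int_g by (intro integral_mono) auto
  moreover have "(\<integral>x. g x \<partial>\<Gamma>) = A * B * (1 - (1 + 1 / A\<^sup>2) * (1 + 1 / B\<^sup>2))
      + 2 / B * (1 + 1 / A\<^sup>2) * A + 2 / A * (1 + 1 / B\<^sup>2) * B - 4 / (A * B)"
    unfolding g_def using int by (simp add: I \<Gamma>.prob_space)
  moreover have "\<dots> = A * B * (1 - (1 - 1 / A\<^sup>2) * (1 - 1 / B\<^sup>2))"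
    using AB by (simp add: field_simps power2_eq_square)
  moreover have "1 / A\<^sup>2 = 1 - w" "1 / B\<^sup>2 = exp (- \<delta>\<^sup>2)"
    unfolding A_def B_def w_def by (simp_all add: exp_minus inverse_eq_divide exp_double[symmetric])
  ultimately have "A * B * (1 - w * (1 - exp (- \<delta>\<^sup>2))) \<le> (\<integral>x. f x \<partial>\<Gamma>)" by simp
  moreover have "exp (- (w * \<delta>\<^sup>2)) \<le> 1 - w * (1 - exp (- \<delta>\<^sup>2))"
    by (rule exp_convex_combination) (auto simp: w_def)
  ultimately have "A * B * exp (- (w * \<delta>\<^sup>2)) \<le> (\<integral>x. f x \<partial>\<Gamma>)"
    using AB by (smt (verit) mult_left_mono mult_pos_pos)
  then have "exp (- (w * \<delta>\<^sup>2)) \<le> (\<integral>x. exp (- (card I * \<delta>\<^sup>2 / 2)) * f x \<partial>\<Gamma>)"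
    unfolding ABprod by (simp add: exp_minus field_simps)
  then have "ennreal (exp (- (w * \<delta>\<^sup>2))) \<le> (\<integral>\<^sup>+x. ennreal (exp (- (card I * \<delta>\<^sup>2 / 2)) * f x) \<partial>\<Gamma>)"
    using int_f f_nonneg by (subst nn_integral_eq_integral) (auto simp: ennreal_leI)
  then show ?thesis
    by (simp add: f_def s_def d_def \<Gamma>_def sum_distrib_left mult.assoc)
qed

section \<open>Mixtures over the centre\<close>

abbreviation "pure_noise n p \<sigma> \<equiv> observation n p \<sigma> (\<lambda>_. 0) (\<lambda>_. 0)"

lemma borel_measurable_cosh_linear:
  "(\<lambda>x. cosh (d * (\<Sum>i\<in>I. c i * x i))) \<in> borel_measurable (\<Pi>\<^sub>M i\<in>I. \<gamma>)" for d :: real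
  unfolding cosh_def by measurable

lemma prob_space_noise: "prob_space (noise n p)"
  unfolding noise_def by (intro prob_space_PiM prob_space_std_normal)

lemma measurable_noise_entry:
  assumes "i < n" "k < p"
  shows "(\<lambda>\<xi>. \<xi> i k) \<in> noise n p \<rightarrow>\<^sub>M borel"
proof -
  have "(\<lambda>\<xi>. \<xi> i k) \<in> noise n p \<rightarrow>\<^sub>M \<gamma>"
    unfolding noise_def using assms
    by (intro measurable_compose[OF measurable_component_singleton[of i] measurable_component_singleton[of k]])
       auto
  then show ?thesis by simp
qed

lemma measurable_obs_entry:
  assumes "i < n" "k < p"
  shows "(\<lambda>Y. Y i k) \<in> obs_space n p \<rightarrow>\<^sub>M borel"
  unfolding obs_space_def using assms
  by (intro measurable_compose[OF measurable_component_singleton[of i] measurable_component_singleton[of k]])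
     auto

lemma measurable_observation [measurable]:
  "observation n p \<sigma> \<theta> \<eta> \<in> noise n p \<rightarrow>\<^sub>M obs_space n p"
  unfolding observation_def obs_space_def
  by (intro measurable_restrict borel_measurable_add borel_measurable_times borel_measurable_const
        measurable_noise_entry) auto

lemma prob_space_obs_law: "prob_space (obs_law n p \<sigma> \<theta> \<eta>)"
  unfolding obs_law_def by (intro prob_space.prob_space_distr prob_space_noise measurable_observation)

lemma sets_obs_law [simp, measurable_cong]: "sets (obs_law n p \<sigma> \<theta> \<eta>) = sets (obs_space n p)"
  by (simp add: obs_law_def)

lemma space_obs_law [simp]: "space (obs_law n p \<sigma> \<theta> \<eta>) = space (obs_space n p)"
  by (simp add: obs_law_def)

text \<open>
  The Cameron-Martin formula in every entry. In units of the noise the entry \<open>(i, k)\<close> is shifted by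
  \<open>\<theta> k * \<eta> i / \<sigma>\<close>, so the product is the likelihood ratio of the observations to pure noise.
\<close>

lemma nn_integral_observation_change:
  assumes "\<sigma> \<noteq> 0" and [measurable]: "f \<in> borel_measurable (obs_space n p)"
  shows "(\<integral>\<^sup>+\<xi>. f (observation n p \<sigma> \<theta> \<eta> \<xi>) \<partial>noise n p)
    = (\<integral>\<^sup>+\<xi>. f (pure_noise n p \<sigma> \<xi>) *
        (\<Prod>i<n. \<Prod>k<p. ennreal (exp (\<theta> k * \<eta> i / \<sigma> * \<xi> i k - (\<theta> k * \<eta> i / \<sigma>)\<^sup>2 / 2))) \<partial>noise n p)"
proof -
  define h where "h i k x = ennreal (exp (\<theta> k * \<eta> i / \<sigma> * x - (\<theta> k * \<eta> i / \<sigma>)\<^sup>2 / 2))" for i k x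
  have [measurable]: "h i k \<in> borel_measurable borel" for i k unfolding h_def by measurable
  have entry: "(\<integral>\<^sup>+x. g (\<theta> k * \<eta> i + \<sigma> * x) \<partial>\<gamma>) = (\<integral>\<^sup>+x. g (\<sigma> * x) * h i k x \<partial>\<gamma>)"
    if [measurable]: "g \<in> borel_measurable borel" for g i k
  proof -
    have "\<sigma> * (x + \<theta> k * \<eta> i / \<sigma>) = \<theta> k * \<eta> i + \<sigma> * x" for x
      using assms(1) by (simp add: field_simps)
    then show ?thesis
      unfolding h_def using nn_integral_std_normal_shift[of "\<lambda>x. g (\<sigma> * x)" "\<theta> k * \<eta> i / \<sigma>"]
      by simp
  qed
  have column: "(\<integral>\<^sup>+x. g (\<lambda>k\<in>{..<p}. \<theta> k * \<eta> i + \<sigma> * x k) \<partial>(\<Pi>\<^sub>M k\<in>{..<p}. \<gamma>))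
      = (\<integral>\<^sup>+x. g (\<lambda>k\<in>{..<p}. \<sigma> * x k) * (\<Prod>k<p. h i k (x k)) \<partial>(\<Pi>\<^sub>M k\<in>{..<p}. \<gamma>))"
    if "g \<in> borel_measurable (\<Pi>\<^sub>M k\<in>{..<p}. borel)" for g i
    using that entry
    by (intro nn_integral_PiM_change[where N="\<lambda>_. borel" and T="\<lambda>k y. \<theta> k * \<eta> i + \<sigma> * y"
          and S="\<lambda>k y. \<sigma> * y", OF product_sigma_finite_std_normal]) auto
  have shift_map: "(\<lambda>x. \<lambda>k\<in>{..<p}. c k + \<sigma> * x k) \<in> (\<Pi>\<^sub>M k\<in>{..<p}. \<gamma>) \<rightarrow>\<^sub>M (\<Pi>\<^sub>M k\<in>{..<p}. borel)" for c
    by measurable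
  have scale_map: "(\<lambda>x. \<lambda>k\<in>{..<p}. \<sigma> * x k) \<in> (\<Pi>\<^sub>M k\<in>{..<p}. \<gamma>) \<rightarrow>\<^sub>M (\<Pi>\<^sub>M k\<in>{..<p}. borel)"
    by measurable
  have prod_h: "(\<lambda>x. \<Prod>k<p. h i k (x k)) \<in> borel_measurable (\<Pi>\<^sub>M k\<in>{..<p}. \<gamma>)" for i
    by measurable
  have "product_sigma_finite (\<lambda>_::nat. \<Pi>\<^sub>M k\<in>{..<p}. \<gamma>)"
    unfolding product_sigma_finite_def
    by (auto intro!: prob_space_imp_sigma_finite prob_space_PiM prob_space_std_normal)
  then have "(\<integral>\<^sup>+\<xi>. f (\<lambda>i\<in>{..<n}. (\<lambda>k\<in>{..<p}. \<theta> k * \<eta> i + \<sigma> * \<xi> i k)) \<partial>noise n p)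
      = (\<integral>\<^sup>+\<xi>. f (\<lambda>i\<in>{..<n}. (\<lambda>k\<in>{..<p}. \<sigma> * \<xi> i k)) * (\<Prod>i<n. \<Prod>k<p. h i k (\<xi> i k)) \<partial>noise n p)"
    unfolding noise_def using column assms(2) shift_map scale_map prod_h
    by (intro nn_integral_PiM_change[where N="\<lambda>_. \<Pi>\<^sub>M k\<in>{..<p}. borel"
          and T="\<lambda>i x. \<lambda>k\<in>{..<p}. \<theta> k * \<eta> i + \<sigma> * x k" and S="\<lambda>i x. \<lambda>k\<in>{..<p}. \<sigma> * x k"
          and h="\<lambda>i x. \<Prod>k<p. h i k (x k)"])
       (auto simp: obs_space_def)
  then show ?thesis by (simp add: observation_def h_def)
qed

declare measurable_noise_entry [measurable] measurable_obs_entry [measurable]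

text \<open>
  The density, with respect to the law of pure noise, of the observations with labels \<open>\<eta>\<close> when the entries of
  \<open>\<theta> / \<sigma>\<close> are independent and uniform on \<open>{- \<delta>, \<delta>}\<close>.
\<close>

definition mixture_density :: "nat \<Rightarrow> nat \<Rightarrow> real \<Rightarrow> (nat \<Rightarrow> real) \<Rightarrow> (nat \<Rightarrow> nat \<Rightarrow> real) \<Rightarrow> real" where
  "mixture_density n p \<delta> \<eta> \<xi> = (\<Prod>k<p. exp (- (n * \<delta>\<^sup>2 / 2)) * cosh (\<delta> * (\<Sum>i<n. \<eta> i * \<xi> i k)))"

lemma measurable_mixture_density [measurable]:
  "mixture_density n p \<delta> \<eta> \<in> borel_measurable (noise n p)"
proof -
  have "(\<lambda>\<xi>. \<Sum>i<n. \<eta> i * \<xi> i k) \<in> borel_measurable (noise n p)" if "k < p" for k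
    using that by measurable
  then show ?thesis
    unfolding mixture_density_def[abs_def] cosh_def by measurable
qed

lemma mixture_density_pos: "mixture_density n p \<delta> \<eta> \<xi> > 0"
  by (simp add: mixture_density_def prod_pos)

lemma labels_square: "\<eta> \<in> labels n \<Longrightarrow> i < n \<Longrightarrow> (\<eta> i)\<^sup>2 = 1"
  by (auto simp: labels_def dest!: PiE_mem)

text \<open>
  The sum over the sign vectors \<open>\<theta>\<close> of the likelihood ratios factors over the coordinates, and in each of them
  the two signs combine to a hyperbolic cosine.
\<close>

lemma sum_sign_vectors_observation:
  assumes "\<sigma> > 0" "\<tau> > 0" and \<eta>: "\<eta> \<in> labels n" and f[measurable]: "f \<in> borel_measurable (obs_space n p)"
  shows "(\<Sum>\<theta>\<in>{..<p} \<rightarrow>\<^sub>E {-\<tau>, \<tau>}. \<integral>\<^sup>+\<xi>. f (observation n p \<sigma> \<theta> \<eta> \<xi>) \<partial>noise n p)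
    = 2 ^ p * (\<integral>\<^sup>+\<xi>. f (pure_noise n p \<sigma> \<xi>) * ennreal (mixture_density n p (\<tau> / \<sigma>) \<eta> \<xi>) \<partial>noise n p)"
proof -
  define h where "h t k \<xi> = exp (\<Sum>i<n. t * \<eta> i / \<sigma> * \<xi> i k - (t * \<eta> i / \<sigma>)\<^sup>2 / 2)"
    for t k and \<xi> :: "nat \<Rightarrow> nat \<Rightarrow> real"
  have [measurable]: "h t k \<in> borel_measurable (noise n p)" if "k < p" for t k
    unfolding h_def using that by measurable
  have h_nonneg: "h t k \<xi> \<ge> 0" for t k \<xi> by (simp add: h_def)
  have h_pair: "(\<Sum>t\<in>{-\<tau>, \<tau>}. h t k \<xi>)
      = 2 * (exp (- (n * (\<tau> / \<sigma>)\<^sup>2 / 2)) * cosh (\<tau> / \<sigma> * (\<Sum>i<n. \<eta> i * \<xi> i k)))" for k \<xi>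
  proof -
    have "(\<Sum>i<n. t * \<eta> i / \<sigma> * \<xi> i k - (t * \<eta> i / \<sigma>)\<^sup>2 / 2)
        = - (n * (t / \<sigma>)\<^sup>2 / 2) + t / \<sigma> * (\<Sum>i<n. \<eta> i * \<xi> i k)" for t
      using \<eta> by (simp add: sum_subtractf power_divide power_mult_distrib labels_square sum_distrib_left mult.assoc)
    then have "h t k \<xi> = exp (- (n * (t / \<sigma>)\<^sup>2 / 2)) * exp (t / \<sigma> * (\<Sum>i<n. \<eta> i * \<xi> i k))" for t
      unfolding h_def by (simp only: exp_add[symmetric])
    then show ?thesis
      using \<open>\<tau> > 0\<close> by (simp add: cosh_def algebra_simps)
  qed
  have swap: "(\<Prod>i<n. \<Prod>k<p. ennreal (exp (\<theta> k * \<eta> i / \<sigma> * \<xi> i k - (\<theta> k * \<eta> i / \<sigma>)\<^sup>2 / 2)))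
      = ennreal (\<Prod>k<p. h (\<theta> k) k \<xi>)" for \<theta> \<xi>
    by (subst prod.swap) (simp add: prod_ennreal prod_nonneg h_def exp_sum)
  have sum_h: "(\<Sum>\<theta>\<in>{..<p} \<rightarrow>\<^sub>E {-\<tau>, \<tau>}. \<Prod>k<p. h (\<theta> k) k \<xi>) = 2 ^ p * mixture_density n p (\<tau> / \<sigma>) \<eta> \<xi>" for \<xi>
    by (subst prod_sum_PiE[symmetric]) (auto simp: h_pair[simplified] mixture_density_def prod.distrib)
  have "(\<Sum>\<theta>\<in>{..<p} \<rightarrow>\<^sub>E {-\<tau>, \<tau>}. \<integral>\<^sup>+\<xi>. f (observation n p \<sigma> \<theta> \<eta> \<xi>) \<partial>noise n p)
      = (\<Sum>\<theta>\<in>{..<p} \<rightarrow>\<^sub>E {-\<tau>, \<tau>}. \<integral>\<^sup>+\<xi>. f (pure_noise n p \<sigma> \<xi>) * ennreal (\<Prod>k<p. h (\<theta> k) k \<xi>) \<partial>noise n p)"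
    by (simp only: nn_integral_observation_change[OF less_imp_neq[OF assms(1), symmetric] f] swap)
  also have "\<dots> = (\<integral>\<^sup>+\<xi>. (\<Sum>\<theta>\<in>{..<p} \<rightarrow>\<^sub>E {-\<tau>, \<tau>}.
      f (pure_noise n p \<sigma> \<xi>) * ennreal (\<Prod>k<p. h (\<theta> k) k \<xi>)) \<partial>noise n p)"
    by (rule nn_integral_sum[symmetric]) measurable
  also have "\<dots> = (\<integral>\<^sup>+\<xi>. 2 ^ p * (f (pure_noise n p \<sigma> \<xi>)
      * ennreal (mixture_density n p (\<tau> / \<sigma>) \<eta> \<xi>)) \<partial>noise n p)"
  proof (rule nn_integral_cong)
    fix \<xi>
    have "(\<Sum>\<theta>\<in>{..<p} \<rightarrow>\<^sub>E {-\<tau>, \<tau>}. ennreal (\<Prod>k<p. h (\<theta> k) k \<xi>))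
        = 2 ^ p * ennreal (mixture_density n p (\<tau> / \<sigma>) \<eta> \<xi>)"
      by (subst sum_ennreal)
         (auto simp: sum_h prod_nonneg h_nonneg ennreal_mult mixture_density_pos less_imp_le
            ennreal_power[symmetric])
    then show "(\<Sum>\<theta>\<in>{..<p} \<rightarrow>\<^sub>E {-\<tau>, \<tau>}. f (pure_noise n p \<sigma> \<xi>) * ennreal (\<Prod>k<p. h (\<theta> k) k \<xi>))
        = 2 ^ p * (f (pure_noise n p \<sigma> \<xi>) * ennreal (mixture_density n p (\<tau> / \<sigma>) \<eta> \<xi>))"
      by (simp only: sum_distrib_left[symmetric] mult.left_commute[of "2 ^ p"])
  qed
  also have "\<dots> = 2 ^ p * (\<integral>\<^sup>+\<xi>. f (pure_noise n p \<sigma> \<xi>) * ennreal (mixture_density n p (\<tau> / \<sigma>) \<eta> \<xi>) \<partial>noise n p)"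
    by (rule nn_integral_cmult) measurable
  finally show ?thesis .
qed

lemma card_sign_vectors: "\<tau> > 0 \<Longrightarrow> card ({..<p} \<rightarrow>\<^sub>E {-\<tau>, \<tau> :: real}) = 2 ^ p"
  by (subst card_PiE) (auto simp: numeral_2_eq_2)

lemma nn_integral_mixture_density:
  assumes "\<delta> > 0" "\<eta> \<in> labels n"
  shows "(\<integral>\<^sup>+\<xi>. ennreal (mixture_density n p \<delta> \<eta> \<xi>) \<partial>noise n p) = 1"
proof -
  interpret prob_space "noise n p" by (rule prob_space_noise)
  have "2 ^ p * 1 = 2 ^ p * (\<integral>\<^sup>+\<xi>. ennreal (mixture_density n p \<delta> \<eta> \<xi>) \<partial>noise n p)"
    using sum_sign_vectors_observation[of 1 \<delta> \<eta> n "\<lambda>_. 1" p] assms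
    by (simp add: emeasure_space_1 card_sign_vectors)
  moreover have "(2 ^ p :: ennreal) \<noteq> 0" "(2 ^ p :: ennreal) \<noteq> \<top>"
    by (auto simp: power_eq_top_ennreal)
  ultimately show ?thesis
    by (subst (asm) ennreal_mult_cancel_left) auto
qed

text \<open>
  Applied to two probability densities with affinity at least \<open>b\<close>, this bounds the integral of their minimum below
  by \<open>b\<^sup>2 - 2 * (b\<^sup>2 / 4) = b\<^sup>2 / 2\<close>; the coefficient \<open>b\<^sup>2 / 4\<close> makes the inequality a complete square.
\<close>

lemma min_ge_geometric_mean:
  fixes x y b :: real
  assumes "x \<ge> 0" "y \<ge> 0" "b \<ge> 0"
  shows "b * sqrt (x * y) \<le> min x y + b\<^sup>2 / 4 * (x + y)"
proof -
  have *: "b * sqrt (u * v) \<le> u + b\<^sup>2 / 4 * (u + v)" if "u \<ge> 0" "v \<ge> 0" for u v :: real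
  proof -
    have "0 \<le> (sqrt u - b * sqrt v / 2)\<^sup>2" by simp
    also have "\<dots> = u - b * sqrt (u * v) + b\<^sup>2 / 4 * v"
      using that by (simp add: power2_diff power_divide power_mult_distrib real_sqrt_mult)
    finally show ?thesis using that by (smt (verit) distrib_left divide_nonneg_nonneg mult_nonneg_nonneg zero_le_power2)
  qed
  show ?thesis using *[of x y] *[of y x] assms by (simp add: min_def mult.commute add.commute)
qed

text \<open>
  Both densities are products over the coordinates \<open>k\<close>, and each factor depends on the \<open>k\<close>-th row of the noise only.
  The rows are independent, so the affinity is the product of the affinities of the coordinates.
\<close>

lemma mixture_affinity_ge:
  fixes \<delta> :: real and n p :: nat
  assumes \<eta>: "\<eta> \<in> labels n" and j: "j < n"
  defines "w \<equiv> 1 - exp (- (real (n - 1) * \<delta>\<^sup>2))"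
  shows "ennreal (exp (- (real p * w * \<delta>\<^sup>2)))
    \<le> (\<integral>\<^sup>+\<xi>. ennreal (sqrt (mixture_density n p \<delta> \<eta> \<xi> * mixture_density n p \<delta> (\<eta>(j := - \<eta> j)) \<xi>)) \<partial>noise n p)"
proof -
  define g where "g x = ennreal (exp (- (n * \<delta>\<^sup>2 / 2)) * sqrt (cosh (\<delta> * (\<Sum>i<n. \<eta> i * x i))
        * cosh (\<delta> * (\<Sum>i<n. (\<eta>(j := - \<eta> j)) i * x i))))" for x :: "nat \<Rightarrow> real"
  have g_measurable: "g \<in> borel_measurable (\<Pi>\<^sub>M i\<in>{..<n}. \<gamma>)"
    unfolding g_def[abs_def]
    by (intro measurable_compose[OF _ measurable_ennreal] borel_measurable_times borel_measurable_const
          measurable_compose[OF _ borel_measurable_sqrt] borel_measurable_cosh_linear)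
  have coord: "ennreal (exp (- (w * \<delta>\<^sup>2))) \<le> (\<integral>\<^sup>+x. g x \<partial>(\<Pi>\<^sub>M i\<in>{..<n}. \<gamma>))"
    using coordinate_affinity_ge[of "{..<n}" j \<eta> \<delta>] \<eta> j
    by (auto simp: labels_def PiE_def Pi_def w_def g_def)
  have split: "ennreal (sqrt (mixture_density n p \<delta> \<eta> \<xi> * mixture_density n p \<delta> (\<eta>(j := - \<eta> j)) \<xi>))
      = (\<Prod>k<p. g (\<lambda>i\<in>{..<n}. \<xi> i k))" for \<xi>
  proof -
    have sqrt_prod: "sqrt (\<Prod>k<p. u k) = (\<Prod>k<p. sqrt (u k))" for u :: "nat \<Rightarrow> real"
      by (induction p) (auto simp: real_sqrt_mult)
    have sqrt_term: "sqrt (exp (- (n * \<delta>\<^sup>2 / 2)) * c * (exp (- (n * \<delta>\<^sup>2 / 2)) * d))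
        = exp (- (n * \<delta>\<^sup>2 / 2)) * sqrt (c * d)" for c d :: real
      by (simp add: real_sqrt_mult mult_ac)
    show ?thesis
      unfolding mixture_density_def prod.distrib[symmetric] sqrt_prod sqrt_term g_def
      by (subst prod_ennreal) (auto intro!: sum.cong prod.cong arg_cong[where f=ennreal])
  qed
  have "ennreal (exp (- (real p * w * \<delta>\<^sup>2))) = (\<Prod>k<p. ennreal (exp (- (w * \<delta>\<^sup>2))))"
    by (simp add: ennreal_power exp_of_nat_mult[symmetric] mult.assoc)
  also have "\<dots> \<le> (\<Prod>k<p. \<integral>\<^sup>+x. g x \<partial>(\<Pi>\<^sub>M i\<in>{..<n}. \<gamma>))"
    using coord by (simp add: power_mono)
  also have "\<dots> = (\<integral>\<^sup>+\<xi>. (\<Prod>k<p. g (\<lambda>i\<in>{..<n}. \<xi> i k)) \<partial>noise n p)"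
    unfolding noise_def
    by (intro nn_integral_PiM_PiM_transpose[symmetric]) (auto intro: prob_space_imp_sigma_finite prob_space_std_normal g_measurable)
  finally show ?thesis by (simp add: split)
qed

lemma label_flip_in: "\<eta> \<in> labels n \<Longrightarrow> j < n \<Longrightarrow> \<eta>(j := - \<eta> j) \<in> labels n"
  by (auto simp: labels_def PiE_def Pi_def extensional_def)

text \<open>
  The sum of the two error probabilities of a test is at least the integral of the minimum of the two densities, here
  of the mixtures over the sign vectors.
\<close>

lemma mixture_test_errors_ge:
  fixes \<sigma> \<tau> :: real and n p :: nat
  assumes "\<sigma> > 0" "\<tau> > 0" and \<eta>: "\<eta> \<in> labels n" and j: "j < n" and A[measurable]: "A \<in> sets (obs_space n p)"
  defines "w \<equiv> 1 - exp (- (real (n - 1) * (\<tau> / \<sigma>)\<^sup>2))"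
  defines "\<eta>' \<equiv> \<eta>(j := - \<eta> j)"
  shows "2 ^ p * (exp (- (2 * (real p * w * (\<tau> / \<sigma>)\<^sup>2))) / 2)
    \<le> (\<Sum>\<theta>\<in>{..<p} \<rightarrow>\<^sub>E {-\<tau>, \<tau>}. measure (obs_law n p \<sigma> \<theta> \<eta>) A
        + measure (obs_law n p \<sigma> \<theta> \<eta>') (space (obs_space n p) - A))"
proof -
  define \<delta> where "\<delta> = \<tau> / \<sigma>"
  define b where "b = exp (- (real p * w * \<delta>\<^sup>2))"
  have \<delta>: "\<delta> > 0" using assms by (simp add: \<delta>_def)
  have \<eta>': "\<eta>' \<in> labels n" unfolding \<eta>'_def using \<eta> j by (rule label_flip_in)
  define P Q where "P = mixture_density n p \<delta> \<eta>" and "Q = mixture_density n p \<delta> \<eta>'"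
  have [measurable]: "P \<in> borel_measurable (noise n p)" "Q \<in> borel_measurable (noise n p)"
    unfolding P_def Q_def by measurable
  have pos: "P \<xi> > 0" "Q \<xi> > 0" for \<xi> by (simp_all add: P_def Q_def mixture_density_pos)
  let ?J = "\<lambda>A \<eta>. \<integral>\<^sup>+\<xi>. indicator A (pure_noise n p \<sigma> \<xi>) * ennreal (mixture_density n p \<delta> \<eta> \<xi>) \<partial>noise n p"
  have law: "(\<Sum>\<theta>\<in>{..<p} \<rightarrow>\<^sub>E {-\<tau>, \<tau>}. ennreal (measure (obs_law n p \<sigma> \<theta> \<zeta>) B)) = 2 ^ p * ?J B \<zeta>"
    if \<zeta>: "\<zeta> \<in> labels n" and [measurable]: "B \<in> sets (obs_space n p)" for \<zeta> B
  proof -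
    have "ennreal (measure (obs_law n p \<sigma> \<theta> \<zeta>) B)
        = (\<integral>\<^sup>+\<xi>. indicator B (observation n p \<sigma> \<theta> \<zeta> \<xi>) \<partial>noise n p)" for \<theta>
    proof -
      interpret prob_space "obs_law n p \<sigma> \<theta> \<zeta>" by (rule prob_space_obs_law)
      have "ennreal (measure (obs_law n p \<sigma> \<theta> \<zeta>) B) = (\<integral>\<^sup>+Y. indicator B Y \<partial>obs_law n p \<sigma> \<theta> \<zeta>)"
        by (simp add: emeasure_eq_measure[symmetric])
      also have "\<dots> = (\<integral>\<^sup>+\<xi>. indicator B (observation n p \<sigma> \<theta> \<zeta> \<xi>) \<partial>noise n p)"
        unfolding obs_law_def by (subst nn_integral_distr) auto
      finally show ?thesis .
    qed
    then show ?thesis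
      using sum_sign_vectors_observation[OF assms(1,2) \<zeta>, of "indicator B" p] by (simp add: \<delta>_def)
  qed
  have "ennreal b * ennreal b \<le> ennreal b * (\<integral>\<^sup>+\<xi>. ennreal (sqrt (P \<xi> * Q \<xi>)) \<partial>noise n p)"
    unfolding P_def Q_def b_def \<eta>'_def w_def \<delta>_def[symmetric]
    by (intro mult_left_mono mixture_affinity_ge \<eta> j) auto
  also have "\<dots> = (\<integral>\<^sup>+\<xi>. ennreal (b * sqrt (P \<xi> * Q \<xi>)) \<partial>noise n p)"
    using pos by (subst nn_integral_cmult[symmetric]) (auto simp: ennreal_mult' b_def)
  also have "\<dots> \<le> (\<integral>\<^sup>+\<xi>. (indicator A (pure_noise n p \<sigma> \<xi>) * ennreal (P \<xi>)
      + indicator (space (obs_space n p) - A) (pure_noise n p \<sigma> \<xi>) * ennreal (Q \<xi>))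
      + ennreal (b\<^sup>2 / 4) * (ennreal (P \<xi>) + ennreal (Q \<xi>)) \<partial>noise n p)"
  proof (rule nn_integral_mono)
    fix \<xi> assume "\<xi> \<in> space (noise n p)"
    then have sp: "pure_noise n p \<sigma> \<xi> \<in> space (obs_space n p)"
      by (rule measurable_space[OF measurable_observation])
    have m: "ennreal (min (P \<xi>) (Q \<xi>)) \<le> indicator A (pure_noise n p \<sigma> \<xi>) * ennreal (P \<xi>)
      + indicator (space (obs_space n p) - A) (pure_noise n p \<sigma> \<xi>) * ennreal (Q \<xi>)"
      using sp by (auto simp: indicator_def intro!: ennreal_leI)
    have "ennreal (b * sqrt (P \<xi> * Q \<xi>)) \<le> ennreal (min (P \<xi>) (Q \<xi>) + b\<^sup>2 / 4 * (P \<xi> + Q \<xi>))"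
      using pos[of \<xi>] by (intro ennreal_leI min_ge_geometric_mean) (auto simp: b_def)
    also have "\<dots> = ennreal (min (P \<xi>) (Q \<xi>)) + ennreal (b\<^sup>2 / 4) * (ennreal (P \<xi>) + ennreal (Q \<xi>))"
      using pos[of \<xi>] by (simp add: ennreal_plus[symmetric] ennreal_mult[symmetric] del: ennreal_plus)
    finally show "ennreal (b * sqrt (P \<xi> * Q \<xi>)) \<le> (indicator A (pure_noise n p \<sigma> \<xi>) * ennreal (P \<xi>)
      + indicator (space (obs_space n p) - A) (pure_noise n p \<sigma> \<xi>) * ennreal (Q \<xi>))
      + ennreal (b\<^sup>2 / 4) * (ennreal (P \<xi>) + ennreal (Q \<xi>))"
      using add_right_mono[OF m] by (rule order_trans)
  qed
  also have "\<dots> = (?J A \<eta> + ?J (space (obs_space n p) - A) \<eta>') + ennreal (b\<^sup>2 / 4) * 2"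
    using nn_integral_mixture_density[OF \<delta> \<eta>] nn_integral_mixture_density[OF \<delta> \<eta>']
    by (simp add: nn_integral_add nn_integral_cmult P_def Q_def one_add_one)
  also have "ennreal (b\<^sup>2 / 4) * 2 = ennreal (b\<^sup>2 / 2)"
    by (simp add: ennreal_mult'[symmetric] flip: ennreal_numeral)
  finally have "ennreal (b * b) \<le> (?J A \<eta> + ?J (space (obs_space n p) - A) \<eta>') + ennreal (b\<^sup>2 / 2)"
    by (simp add: ennreal_mult' b_def)
  then have le: "2 ^ p * ennreal (b * b)
      \<le> 2 ^ p * ((?J A \<eta> + ?J (space (obs_space n p) - A) \<eta>') + ennreal (b\<^sup>2 / 2))"
    by (rule mult_left_mono) simp
  have "ennreal (2 ^ p * (b * b)) = 2 ^ p * ennreal (b * b)"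
    by (subst ennreal_mult) (auto simp: ennreal_power[symmetric])
  also have "\<dots> \<le> 2 ^ p * ((?J A \<eta> + ?J (space (obs_space n p) - A) \<eta>') + ennreal (b\<^sup>2 / 2))"
    by (rule le)
  also have "\<dots> = (\<Sum>\<theta>\<in>{..<p} \<rightarrow>\<^sub>E {-\<tau>, \<tau>}. ennreal (measure (obs_law n p \<sigma> \<theta> \<eta>) A))
      + (\<Sum>\<theta>\<in>{..<p} \<rightarrow>\<^sub>E {-\<tau>, \<tau>}. ennreal (measure (obs_law n p \<sigma> \<theta> \<eta>') (space (obs_space n p) - A)))
      + 2 ^ p * ennreal (b\<^sup>2 / 2)"
    by (subst (1 2) law) (auto simp: \<eta> \<eta>' distrib_left)
  also have "2 ^ p * ennreal (b\<^sup>2 / 2) = ennreal (2 ^ p * (b\<^sup>2 / 2))"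
    by (subst ennreal_mult) (auto simp: ennreal_power[symmetric])
  also have "(\<Sum>\<theta>\<in>{..<p} \<rightarrow>\<^sub>E {-\<tau>, \<tau>}. ennreal (measure (obs_law n p \<sigma> \<theta> \<eta>) A))
      + (\<Sum>\<theta>\<in>{..<p} \<rightarrow>\<^sub>E {-\<tau>, \<tau>}. ennreal (measure (obs_law n p \<sigma> \<theta> \<eta>') (space (obs_space n p) - A)))
      + ennreal (2 ^ p * (b\<^sup>2 / 2)) = ennreal ((\<Sum>\<theta>\<in>{..<p} \<rightarrow>\<^sub>E {-\<tau>, \<tau>}. measure (obs_law n p \<sigma> \<theta> \<eta>) A)
      + (\<Sum>\<theta>\<in>{..<p} \<rightarrow>\<^sub>E {-\<tau>, \<tau>}. measure (obs_law n p \<sigma> \<theta> \<eta>') (space (obs_space n p) - A))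
      + 2 ^ p * (b\<^sup>2 / 2))"
    by (simp add: sum_nonneg)
  finally have "2 ^ p * (b * b) \<le> (\<Sum>\<theta>\<in>{..<p} \<rightarrow>\<^sub>E {-\<tau>, \<tau>}. measure (obs_law n p \<sigma> \<theta> \<eta>) A)
      + (\<Sum>\<theta>\<in>{..<p} \<rightarrow>\<^sub>E {-\<tau>, \<tau>}. measure (obs_law n p \<sigma> \<theta> \<eta>') (space (obs_space n p) - A))
      + 2 ^ p * (b\<^sup>2 / 2)"
    by (subst (asm) ennreal_le_iff) (intro add_nonneg_nonneg sum_nonneg measure_nonneg; simp)
  then have "2 ^ p * (b\<^sup>2 / 2) \<le> (\<Sum>\<theta>\<in>{..<p} \<rightarrow>\<^sub>E {-\<tau>, \<tau>}. measure (obs_law n p \<sigma> \<theta> \<eta>) A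
        + measure (obs_law n p \<sigma> \<theta> \<eta>') (space (obs_space n p) - A))"
    by (simp add: sum.distrib power2_eq_square)
  moreover have "b\<^sup>2 = exp (- (2 * (real p * w * (\<tau> / \<sigma>)\<^sup>2)))"
    unfolding b_def \<delta>_def by (simp add: exp_double[symmetric])
  ultimately show ?thesis by simp
qed

section \<open>Loss and risk\<close>

lemma label_eq: "\<eta> \<in> labels n \<Longrightarrow> i < n \<Longrightarrow> \<eta> i = 1 \<or> \<eta> i = -1"
  by (auto simp: labels_def dest!: PiE_mem)

lemma finite_labels: "finite (labels n)" and labels_nonempty: "labels n \<noteq> {}"
  by (auto simp: labels_def PiE_eq_empty_iff intro!: finite_PiE)

lemma sum_label_product_bound:
  assumes "\<eta>' \<in> labels n" "\<eta> \<in> labels n"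
  shows "\<bar>\<Sum>j<n. \<eta>' j * \<eta> j\<bar> \<le> n"
proof -
  have "\<bar>\<Sum>j<n. \<eta>' j * \<eta> j\<bar> \<le> (\<Sum>j<n. \<bar>\<eta>' j * \<eta> j\<bar>)" by (rule sum_abs)
  also have "\<dots> = (\<Sum>j<n. 1)"
    using assms label_eq[of \<eta>' n] label_eq[of \<eta> n] by (intro sum.cong refl) (force simp: abs_mult)
  finally show ?thesis by simp
qed

lemma loss_eq:
  assumes "\<eta>' \<in> labels n" "\<eta> \<in> labels n"
  shows "loss n \<eta>' \<eta> = n - \<bar>\<Sum>j<n. \<eta>' j * \<eta> j\<bar>"
proof -
  have "(\<Sum>j<n. \<bar>\<eta>' j - \<nu> * \<eta> j\<bar>) = n - \<nu> * (\<Sum>j<n. \<eta>' j * \<eta> j)" if "\<nu> \<in> {-1, 1}" for \<nu> :: real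
  proof -
    have "(\<Sum>j<n. \<bar>\<eta>' j - \<nu> * \<eta> j\<bar>) = (\<Sum>j<n. 1 - \<nu> * (\<eta>' j * \<eta> j))"
      using that assms label_eq[of \<eta>' n] label_eq[of \<eta> n] by (intro sum.cong refl) force
    then show ?thesis by (simp add: sum_subtractf sum_distrib_left)
  qed
  then show ?thesis by (simp add: loss_def min_def abs_if)
qed

lemma loss_bounds:
  assumes "\<eta>' \<in> labels n" "\<eta> \<in> labels n"
  shows "0 \<le> loss n \<eta>' \<eta>" "loss n \<eta>' \<eta> \<le> n"
  using sum_label_product_bound[OF assms] by (auto simp: loss_eq[OF assms])

text \<open>
  Products of two labels do not see the global sign, so counting the pairs on which they are wrong removes the
  minimum over \<open>\<nu>\<close> from the loss. With \<open>s\<close> the inner product of the two label vectors, the loss is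
  \<open>n - \<bar>s\<bar>\<close> and the number of wrong ordered pairs is \<open>(n\<^sup>2 - s\<^sup>2) / 2\<close>.
\<close>

lemma loss_ge_pairs:
  assumes "\<eta>' \<in> labels n" "\<eta> \<in> labels n"
  shows "(\<Sum>i<n. \<Sum>j<n. of_bool (\<eta>' i * \<eta>' j \<noteq> \<eta> i * \<eta> j)) \<le> n * loss n \<eta>' \<eta>"
proof -
  define s where "s = (\<Sum>j<n. \<eta>' j * \<eta> j)"
  have "(\<Sum>i<n. \<Sum>j<n. of_bool (\<eta>' i * \<eta>' j \<noteq> \<eta> i * \<eta> j))
      = (\<Sum>i<n. \<Sum>j<n. (1 - (\<eta>' i * \<eta> i) * (\<eta>' j * \<eta> j)) / 2)"
  proof (intro sum.cong refl)
    fix i j assume "i \<in> {..<n}" "j \<in> {..<n}"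
    with label_eq[OF assms(1), of i] label_eq[OF assms(1), of j] label_eq[OF assms(2), of i] label_eq[OF assms(2), of j]
    show "of_bool (\<eta>' i * \<eta>' j \<noteq> \<eta> i * \<eta> j) = (1 - (\<eta>' i * \<eta> i) * (\<eta>' j * \<eta> j)) / 2"
      by auto
  qed
  also have "\<dots> = (real n * n - s * s) / 2"
    by (simp add: s_def sum_divide_distrib[symmetric] sum_subtractf sum_product)
  also have "\<dots> = (n - \<bar>s\<bar>) * (n + \<bar>s\<bar>) / 2"
    using abs_mult_self[of s] by (simp add: algebra_simps)
  also have "\<dots> \<le> (n - \<bar>s\<bar>) * (n + n) / 2"
    using sum_label_product_bound[OF assms]
    by (intro divide_right_mono mult_left_mono) (auto simp: s_def)
  finally show ?thesis by (simp add: loss_eq[OF assms] s_def algebra_simps)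
qed

lemma estimator_in_labels: "est \<in> estimators n p \<Longrightarrow> Y \<in> space (obs_space n p) \<Longrightarrow> est Y \<in> labels n"
  unfolding estimators_def by (auto dest: measurable_space)

lemma measurable_estimator_compose:
  assumes "est \<in> estimators n p" "\<And>v. v \<in> labels n \<Longrightarrow> g v \<in> space N"
  shows "(\<lambda>Y. g (est Y)) \<in> obs_space n p \<rightarrow>\<^sub>M N"
  using assms unfolding estimators_def
  by (auto intro!: measurable_compose[of est _ "count_space (labels n)"])

lemma estimators_nonempty: "estimators n p \<noteq> {}"
proof -
  obtain v where "v \<in> labels n" using labels_nonempty by auto
  then have "(\<lambda>_. v) \<in> estimators n p" unfolding estimators_def by simp
  then show ?thesis by auto
qed

lemma integrable_loss:
  assumes est: "est \<in> estimators n p" and \<eta>: "\<eta> \<in> labels n"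
  shows "integrable (obs_law n p \<sigma> \<theta> \<eta>') (\<lambda>Y. loss n (est Y) \<eta>)"
proof -
  interpret prob_space "obs_law n p \<sigma> \<theta> \<eta>'" by (rule prob_space_obs_law)
  show ?thesis
  proof (rule integrable_const_bound[of _ n])
    show "AE Y in obs_law n p \<sigma> \<theta> \<eta>'. norm (loss n (est Y) \<eta>) \<le> n"
      using loss_bounds[OF estimator_in_labels[OF est] \<eta>] by (intro AE_I2) auto
    show "(\<lambda>Y. loss n (est Y) \<eta>) \<in> borel_measurable (obs_law n p \<sigma> \<theta> \<eta>')"
      using measurable_estimator_compose[OF est, of "\<lambda>v. loss n v \<eta>" borel]
      by (simp cong: measurable_cong_sets)
  qed
qed

definition risk :: "nat \<Rightarrow> nat \<Rightarrow> real \<Rightarrow> ((nat \<Rightarrow> nat \<Rightarrow> real) \<Rightarrow> nat \<Rightarrow> real) \<Rightarrow> (nat \<Rightarrow> real) \<Rightarrow> (nat \<Rightarrow> real) \<Rightarrow> real" where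
  "risk n p \<sigma> est \<theta> \<eta> = 1 / real n * (\<integral>Y. loss n (est Y) \<eta> \<partial>obs_law n p \<sigma> \<theta> \<eta>)"

lemma risk_bounds:
  assumes "est \<in> estimators n p" "\<eta> \<in> labels n"
  shows "0 \<le> risk n p \<sigma> est \<theta> \<eta>" "risk n p \<sigma> est \<theta> \<eta> \<le> 1"
proof -
  interpret prob_space "obs_law n p \<sigma> \<theta> \<eta>" by (rule prob_space_obs_law)
  note b = loss_bounds[OF estimator_in_labels[OF assms(1)] assms(2)]
  show "0 \<le> risk n p \<sigma> est \<theta> \<eta>"
    unfolding risk_def using b by (intro mult_nonneg_nonneg integral_nonneg_AE AE_I2) auto
  have "(\<integral>Y. loss n (est Y) \<eta> \<partial>obs_law n p \<sigma> \<theta> \<eta>) \<le> n"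
    using b by (intro integral_le_const integrable_loss assms AE_I2) auto
  then show "risk n p \<sigma> est \<theta> \<eta> \<le> 1"
    unfolding risk_def by (cases "n = 0") (auto simp: field_simps)
qed

lemma worst_risk_bdd:
  "est \<in> estimators n p \<Longrightarrow> bdd_above ((\<lambda>(\<theta>, \<eta>). risk n p \<sigma> est \<theta> \<eta>) ` params n p \<Delta>)"
  unfolding bdd_above_def by (rule exI[of _ 1]) (use risk_bounds(2) in \<open>auto simp only: params_def\<close>)

lemma risk_le_worst_risk:
  assumes "est \<in> estimators n p" "(\<theta>, \<eta>) \<in> params n p \<Delta>"
  shows "risk n p \<sigma> est \<theta> \<eta> \<le> (SUP (\<theta>, \<eta>)\<in>params n p \<Delta>. risk n p \<sigma> est \<theta> \<eta>)"
  using cSUP_upper[OF assms(2) worst_risk_bdd[OF assms(1)]] by simp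

lemma minimax_risk_eq:
  "minimax_risk n p \<sigma> \<Delta> = (INF est\<in>estimators n p. SUP (\<theta>, \<eta>)\<in>params n p \<Delta>. risk n p \<sigma> est \<theta> \<eta>)"
  by (simp add: minimax_risk_def risk_def)

section \<open>The lower bound\<close>

lemma risk_ge_pair_errors:
  assumes est: "est \<in> estimators n p" and \<eta>: "\<eta> \<in> labels n" and "n > 0"
  shows "(\<Sum>i<n. \<Sum>j<n. measure (obs_law n p \<sigma> \<theta> \<eta>)
      {Y \<in> space (obs_space n p). est Y i * est Y j \<noteq> \<eta> i * \<eta> j}) \<le> real n * n * risk n p \<sigma> est \<theta> \<eta>"
proof -
  interpret prob_space "obs_law n p \<sigma> \<theta> \<eta>" by (rule prob_space_obs_law)
  define A where "A i j = {Y \<in> space (obs_space n p). est Y i * est Y j \<noteq> \<eta> i * \<eta> j}" for i j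
  have [measurable]: "A i j \<in> sets (obs_space n p)" for i j
    unfolding A_def
    using measurable_estimator_compose[OF est, of "\<lambda>v. v i * v j \<noteq> \<eta> i * \<eta> j" "count_space UNIV"]
    by (simp add: pred_def)
  have int: "integrable (obs_law n p \<sigma> \<theta> \<eta>) (indicator (A i j) :: _ \<Rightarrow> real)" for i j
    by (rule integrable_real_indicator) (auto simp: emeasure_eq_measure)
  have "(\<Sum>i<n. \<Sum>j<n. measure (obs_law n p \<sigma> \<theta> \<eta>) (A i j))
      = (\<integral>Y. (\<Sum>i<n. \<Sum>j<n. indicator (A i j) Y) \<partial>obs_law n p \<sigma> \<theta> \<eta>)"
    by (simp add: Bochner_Integration.integral_sum Bochner_Integration.integrable_sum int)
  also have "\<dots> \<le> (\<integral>Y. n * loss n (est Y) \<eta> \<partial>obs_law n p \<sigma> \<theta> \<eta>)"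
  proof (rule integral_mono)
    fix Y assume Y: "Y \<in> space (obs_law n p \<sigma> \<theta> \<eta>)"
    have "(\<Sum>i<n. \<Sum>j<n. indicator (A i j) Y) = (\<Sum>i<n. \<Sum>j<n. of_bool (est Y i * est Y j \<noteq> \<eta> i * \<eta> j) :: real)"
      using Y by (intro sum.cong refl) (auto simp: A_def indicator_def)
    also have "\<dots> \<le> n * loss n (est Y) \<eta>"
      using Y by (intro loss_ge_pairs \<eta> estimator_in_labels[OF est]) auto
    finally show "(\<Sum>i<n. \<Sum>j<n. indicator (A i j) Y) \<le> n * loss n (est Y) \<eta>" .
  qed (intro Bochner_Integration.integrable_sum int integrable_mult_right integrable_loss est \<eta>)+
  also have "\<dots> = real n * n * risk n p \<sigma> est \<theta> \<eta>"
    using \<open>n > 0\<close> by (simp add: risk_def)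
  finally show ?thesis by (simp add: A_def)
qed

text \<open>
  The uniform distribution on the labels is invariant under reversing the label of \<open>j\<close>; this pairs the two
  hypotheses in the test of whether \<open>i\<close> and \<open>j\<close> have equal labels.
\<close>

lemma sum_labels_flip:
  fixes g :: "(nat \<Rightarrow> real) \<Rightarrow> real"
  assumes "j < n"
  shows "(\<Sum>\<eta>\<in>labels n. g (\<eta>(j := - \<eta> j))) = (\<Sum>\<eta>\<in>labels n. g \<eta>)"
proof -
  have "bij_betw (\<lambda>\<eta>. \<eta>(j := - \<eta> j)) (labels n) (labels n)"
    by (rule bij_betw_byWitness[where f'="\<lambda>\<eta>. \<eta>(j := - \<eta> j)"]) (auto simp: label_flip_in assms)
  then show ?thesis by (rule sum.reindex_bij_betw)
qed

text \<open>
  With \<open>s = \<Delta>\<^sup>2 / \<sigma>\<^sup>2 = p * \<delta>\<^sup>2\<close> the left side is \<open>s * (1 - exp (- (n - 1) * \<delta>\<^sup>2))\<close>. The second factor is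
  at most the minimum of \<open>1\<close> and \<open>x = n * \<delta>\<^sup>2\<close>, hence at most \<open>2 * x / (1 + x)\<close>, and \<open>s * x / (1 + x)\<close> is the
  squared signal-to-noise ratio.
\<close>

lemma affinity_exponent_le_snr:
  fixes n p :: nat and \<sigma> \<Delta> :: real
  assumes "n > 0" "p > 0" "\<sigma> > 0" "\<Delta> > 0"
  defines "\<delta> \<equiv> \<Delta> / sqrt p / \<sigma>"
  shows "real p * (1 - exp (- (real (n - 1) * \<delta>\<^sup>2))) * \<delta>\<^sup>2 \<le> 2 * (snr n p \<sigma> \<Delta>)\<^sup>2"
proof -
  define s where "s = \<Delta>\<^sup>2 / \<sigma>\<^sup>2"
  have s: "s > 0" using assms by (simp add: s_def)
  have \<delta>2: "\<delta>\<^sup>2 = s / p" using assms by (simp add: \<delta>_def s_def power_divide power_mult_distrib)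
  have snr2: "(snr n p \<sigma> \<Delta>)\<^sup>2 = s\<^sup>2 / (s + p / n)"
    using s by (simp add: snr_def s_def[symmetric] power_divide)
  define x where "x = n * s / p"
  have x: "x > 0" using assms s by (simp add: x_def)
  have "1 - exp (- (real (n - 1) * \<delta>\<^sup>2)) \<le> 1 - exp (- x)"
    using assms(1-4) s by (auto simp: \<delta>2 x_def of_nat_diff intro!: divide_right_mono mult_right_mono)
  also have "\<dots> \<le> 2 * x / (1 + x)"
  proof (cases "x \<le> 1")
    case True
    have "1 - exp (- x) \<le> x" using exp_ge_add_one_self[of "- x"] by simp
    also have "x \<le> 2 * x / (1 + x)" using x True by (simp add: field_simps)
    finally show ?thesis .
  next
    case False
    then have "1 \<le> 2 * x / (1 + x)" by (simp add: field_simps)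
    then show ?thesis by (smt (verit) exp_gt_zero)
  qed
  finally have "(1 - exp (- (real (n - 1) * \<delta>\<^sup>2))) * s \<le> 2 * x / (1 + x) * s"
    using s by (intro mult_right_mono) auto
  also have "\<dots> = 2 * (snr n p \<sigma> \<Delta>)\<^sup>2"
    unfolding snr2 using assms s by (simp add: x_def field_simps power2_eq_square)
  finally show ?thesis using assms(1-4) by (simp add: \<delta>2 mult.commute)
qed

text \<open>
  The worst risk is at least its average over the uniform distribution on \<open>{- \<tau>, \<tau>}\<^sup>p\<close> and on the labels, where
  \<open>\<tau> = \<Delta> / sqrt p\<close> puts \<open>\<theta>\<close> exactly on the sphere of radius \<open>\<Delta>\<close>. This average is bounded below by that of the
  error probabilities for the pairs, of which there are at least \<open>n\<^sup>2 / 2\<close> ordered ones with \<open>i \<noteq> j\<close>.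
\<close>

lemma minimax_risk_ge:
  assumes "n \<ge> 2" "p > 0" "\<sigma> > 0" "\<Delta> > 0"
  shows "1 / 8 * exp (- 4 * (snr n p \<sigma> \<Delta>)\<^sup>2) \<le> minimax_risk n p \<sigma> \<Delta>"
  unfolding minimax_risk_eq
proof (rule cINF_greatest[OF estimators_nonempty])
  fix est assume est: "est \<in> estimators n p"
  define R where "R = (SUP (\<theta>, \<eta>)\<in>params n p \<Delta>. risk n p \<sigma> est \<theta> \<eta>)"
  define \<tau> where "\<tau> = \<Delta> / sqrt p"
  define \<Theta> where "\<Theta> = {..<p} \<rightarrow>\<^sub>E {-\<tau>, \<tau>}"
  define E where "E = exp (- 4 * (snr n p \<sigma> \<Delta>)\<^sup>2) / 2"
  define err where "err \<theta> \<eta> i j = measure (obs_law n p \<sigma> \<theta> \<eta>)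
      {Y \<in> space (obs_space n p). est Y i * est Y j \<noteq> \<eta> i * \<eta> j}" for \<theta> \<eta> i j
  have \<tau>: "\<tau> > 0" using assms by (simp add: \<tau>_def)
  have n: "n > 0" using assms by simp
  have fin: "finite \<Theta>" unfolding \<Theta>_def by (intro finite_PiE) auto
  have card: "card \<Theta> = 2 ^ p" unfolding \<Theta>_def using \<tau> by (rule card_sign_vectors)
  have cardL: "card (labels n) > 0" using finite_labels labels_nonempty by (simp add: card_gt_0_iff)
  have in_params: "(\<theta>, \<eta>) \<in> params n p \<Delta>" if "\<theta> \<in> \<Theta>" "\<eta> \<in> labels n" for \<theta> \<eta>
  proof -
    have "(\<theta> k)\<^sup>2 = \<tau>\<^sup>2" if "k < p" for k
      using \<open>\<theta> \<in> \<Theta>\<close> that by (auto simp: \<Theta>_def dest!: PiE_mem)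
    then have "L2_set \<theta> {..<p} = sqrt (p * \<tau>\<^sup>2)" by (simp add: L2_set_def)
    also have "\<dots> = \<Delta>" using assms by (simp add: \<tau>_def power_divide)
    finally show ?thesis using that by (auto simp: params_def \<Theta>_def PiE_def)
  qed
  have two_point: "2 ^ p * E \<le> (\<Sum>\<theta>\<in>\<Theta>. err \<theta> \<eta> i j + err \<theta> (\<eta>(j := - \<eta> j)) i j)"
    if \<eta>: "\<eta> \<in> labels n" and ij: "i < n" "j < n" "i \<noteq> j" for \<eta> i j
  proof -
    define A where "A = {Y \<in> space (obs_space n p). est Y i * est Y j \<noteq> \<eta> i * \<eta> j}"
    have A: "A \<in> sets (obs_space n p)"
      unfolding A_def
      using measurable_estimator_compose[OF est, of "\<lambda>v. v i * v j \<noteq> \<eta> i * \<eta> j" "count_space UNIV"]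
      by (simp add: pred_def)
    have "space (obs_space n p) - A
        = {Y \<in> space (obs_space n p). est Y i * est Y j \<noteq> (\<eta>(j := - \<eta> j)) i * (\<eta>(j := - \<eta> j)) j}"
    proof -
      have "(est Y i * est Y j = \<eta> i * \<eta> j) \<longleftrightarrow> (est Y i * est Y j \<noteq> - (\<eta> i * \<eta> j))"
        if "Y \<in> space (obs_space n p)" for Y
        using label_eq[OF estimator_in_labels[OF est that], of i] label_eq[OF estimator_in_labels[OF est that], of j]
          label_eq[OF \<eta>, of i] label_eq[OF \<eta>, of j] ij by auto
      then show ?thesis using ij by (auto simp: A_def)
    qed
    with mixture_test_errors_ge[OF \<open>\<sigma> > 0\<close> \<tau> \<eta> \<open>j < n\<close> A]
    have "2 ^ p * (exp (- (2 * (real p * (1 - exp (- (real (n - 1) * (\<tau> / \<sigma>)\<^sup>2))) * (\<tau> / \<sigma>)\<^sup>2))) / 2)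
        \<le> (\<Sum>\<theta>\<in>\<Theta>. err \<theta> \<eta> i j + err \<theta> (\<eta>(j := - \<eta> j)) i j)"
      by (simp add: \<Theta>_def err_def A_def)
    moreover have "E \<le> exp (- (2 * (real p * (1 - exp (- (real (n - 1) * (\<tau> / \<sigma>)\<^sup>2))) * (\<tau> / \<sigma>)\<^sup>2))) / 2"
      unfolding E_def \<tau>_def
      using affinity_exponent_le_snr[OF n assms(2-4)] by (simp add: mult_ac)
    ultimately show ?thesis by (smt (verit) mult_left_mono zero_le_power)
  qed
  have pair: "card (labels n) * (2 ^ p * E) \<le> 2 * (\<Sum>\<eta>\<in>labels n. \<Sum>\<theta>\<in>\<Theta>. err \<theta> \<eta> i j)"
    if ij: "i < n" "j < n" "i \<noteq> j" for i j
  proof -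
    have "card (labels n) * (2 ^ p * E)
        \<le> (\<Sum>\<eta>\<in>labels n. \<Sum>\<theta>\<in>\<Theta>. err \<theta> \<eta> i j + err \<theta> (\<eta>(j := - \<eta> j)) i j)"
      using two_point[OF _ ij] by (intro sum_bounded_below) auto
    also have "\<dots> = 2 * (\<Sum>\<eta>\<in>labels n. \<Sum>\<theta>\<in>\<Theta>. err \<theta> \<eta> i j)"
      using sum_labels_flip[OF \<open>j < n\<close>, of "\<lambda>\<eta>. \<Sum>\<theta>\<in>\<Theta>. err \<theta> \<eta> i j"] by (simp add: sum.distrib)
    finally show ?thesis .
  qed
  have "(\<Sum>i<n. \<Sum>j\<in>{..<n} - {i}. card (labels n) * (2 ^ p * E))
      \<le> (\<Sum>i<n. \<Sum>j\<in>{..<n} - {i}. 2 * (\<Sum>\<eta>\<in>labels n. \<Sum>\<theta>\<in>\<Theta>. err \<theta> \<eta> i j))"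
    by (intro sum_mono pair) auto
  also have "\<dots> \<le> (\<Sum>i<n. \<Sum>j<n. 2 * (\<Sum>\<eta>\<in>labels n. \<Sum>\<theta>\<in>\<Theta>. err \<theta> \<eta> i j))"
    by (intro sum_mono sum_mono2) (auto intro!: sum_nonneg simp: err_def)
  also have "\<dots> = 2 * (\<Sum>\<eta>\<in>labels n. \<Sum>\<theta>\<in>\<Theta>. \<Sum>i<n. \<Sum>j<n. err \<theta> \<eta> i j)"
    unfolding sum_distrib_left[symmetric]
    by (subst sum.swap[of _ "labels n"], subst sum.swap[of _ "labels n"],
        subst sum.swap[of _ "\<Theta>"], subst sum.swap[of _ "\<Theta>"], rule refl)
  also have "\<dots> \<le> 2 * (\<Sum>\<eta>\<in>labels n. \<Sum>\<theta>\<in>\<Theta>. real n * n * R)"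
  proof (intro mult_left_mono sum_mono)
    fix \<eta> \<theta> assume "\<eta> \<in> labels n" "\<theta> \<in> \<Theta>"
    then show "(\<Sum>i<n. \<Sum>j<n. err \<theta> \<eta> i j) \<le> real n * n * R"
      using risk_ge_pair_errors[OF est _ n, of \<eta> \<sigma> \<theta>] risk_le_worst_risk[OF est in_params, of \<theta> \<eta> \<sigma>]
      unfolding err_def R_def by (smt (verit) mult_left_mono of_nat_0_le_iff mult_nonneg_nonneg)
  qed simp
  finally have "real n * (real n - 1) * (card (labels n) * (2 ^ p * E)) \<le> real n * n * (2 * (card (labels n) * (2 ^ p * R)))"
    using n by (simp add: card of_nat_diff mult_ac)
  then have "(real n - 1) * E \<le> n * (2 * R)"
    using n cardL by (simp add: mult_ac)
  moreover have "real n / 2 * E \<le> (real n - 1) * E"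
    using assms(1) by (intro mult_right_mono) (auto simp: E_def)
  ultimately have "n * (E / 4) \<le> n * R" by linarith
  then have "E / 4 \<le> R" using n by simp
  then show "1 / 8 * exp (- 4 * (snr n p \<sigma> \<Delta>)\<^sup>2) \<le> (SUP (\<theta>, \<eta>)\<in>params n p \<Delta>. risk n p \<sigma> est \<theta> \<eta>)"
    by (simp add: E_def R_def)
qed

section \<open>The upper bound\<close>

lemma ex_measurable_argmax:
  fixes F :: "'l \<Rightarrow> 'a \<Rightarrow> real"
  assumes "finite L" "L \<noteq> {}" "\<And>l. l \<in> L \<Longrightarrow> F l \<in> borel_measurable M"
  shows "\<exists>g \<in> M \<rightarrow>\<^sub>M count_space L. \<forall>x\<in>space M. \<forall>l\<in>L. F l x \<le> F (g x) x"
  using assms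
proof (induction L rule: finite_ne_induct)
  case (singleton l)
  show ?case by (intro bexI[of _ "\<lambda>_. l"]) auto
next
  case (insert l L)
  have F: "F l' \<in> borel_measurable M" if "l' \<in> insert l L" for l' using insert.prems that .
  then obtain g where g: "g \<in> M \<rightarrow>\<^sub>M count_space L"
    and max: "\<forall>x\<in>space M. \<forall>l\<in>L. F l x \<le> F (g x) x"
    using insert.IH by blast
  have Fg: "(\<lambda>x. F (g x) x) \<in> borel_measurable M"
    by (rule measurable_compose_countable'[OF _ g]) (use F insert.hyps in \<open>simp_all add: countable_finite\<close>)
  have g': "g \<in> M \<rightarrow>\<^sub>M count_space (insert l L)"
    by (rule measurable_compose[OF g, of "\<lambda>v. v"]) auto
  have "(\<lambda>x. if F (g x) x \<le> F l x then l else g x) \<in> M \<rightarrow>\<^sub>M count_space (insert l L)"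
    by (intro measurable_If g' borel_measurable_le Fg F) (simp_all add: measurable_const)
  then show ?case
  proof (rule bexI[rotated])
    show "\<forall>x\<in>space M. \<forall>l'\<in>insert l L. F l' x
      \<le> F (if F (g x) x \<le> F l x then l else g x) x"
      using max by (auto intro: order_trans)
  qed
qed

text \<open>
  For \<open>2 * n * l \<le> 1\<close> the quadratic corrections in the exact exponential moment are at most \<open>l\<^sup>2\<close> times
  \<open>m * N * (n * t\<^sup>2 + 1)\<close>; the summand \<open>1\<close> comes from the normalising factor \<open>1 / sqrt (1 - \<beta>) \<le> exp \<beta>\<close>.
\<close>

lemma coordinate_chernoff:
  fixes e :: "nat \<Rightarrow> real" and l t :: real
  assumes T: "T \<subseteq> {..<n}" and e: "\<And>i. i < n \<Longrightarrow> e i \<in> {-1, 1}"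
    and l: "0 \<le> l" "2 * real n * l \<le> 1" and "n > 0"
  defines "m \<equiv> real (card T)" and "N \<equiv> real (card ({..<n} - T))"
  shows "(\<integral>\<^sup>+x. ennreal (exp (- l * ((\<Sum>i\<in>{..<n} - T. t + e i * x i) * (\<Sum>i\<in>T. t + e i * x i)))) \<partial>(\<Pi>\<^sub>M i\<in>{..<n}. \<gamma>))
    \<le> ennreal (exp (- (m * N) * (l * t\<^sup>2 - l\<^sup>2 * (n * t\<^sup>2 + 1))))"
proof -
  define \<beta> where "\<beta> = l\<^sup>2 * m * N"
  define \<kappa> where "\<kappa> = N\<^sup>2 * m * (l * t * (1 - l * m))\<^sup>2"
  have mN: "m + N = n" "m \<ge> 0" "N \<ge> 0"
    using T card_mono[OF _ T] by (auto simp: m_def N_def card_Diff_subset finite_subset of_nat_diff)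
  have "2 * l * m \<le> 1" "2 * l * N \<le> 1"
  proof -
    have "2 * l * m \<le> 2 * l * n" "2 * l * N \<le> 2 * l * n"
      using l mN by (auto intro!: mult_left_mono)
    with l show "2 * l * m \<le> 1" "2 * l * N \<le> 1" by (auto simp: mult_ac)
  qed
  then have lm: "0 \<le> l * m" "l * m \<le> 1 / 2" and lN: "0 \<le> l * N" "l * N \<le> 1 / 2"
    using l mN by auto
  have \<beta>: "0 \<le> \<beta>" "\<beta> \<le> 1 / 4"
  proof -
    have "\<beta> = (l * m) * (l * N)" by (simp add: \<beta>_def power2_eq_square)
    moreover have "(l * m) * (l * N) \<le> 1 / 2 * (1 / 2)" using lm lN by (intro mult_mono) auto
    ultimately show "0 \<le> \<beta>" "\<beta> \<le> 1 / 4" using lm lN by simp_all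
  qed
  have "1 / sqrt (1 - \<beta>) \<le> exp \<beta>"
  proof -
    have "1 \<le> (1 + 2 * \<beta>) * (1 - \<beta>)"
      using mult_left_mono[OF \<beta>(2) \<beta>(1)] \<beta> by (simp add: algebra_simps)
    also have "\<dots> \<le> exp (2 * \<beta>) * (1 - \<beta>)"
      using \<beta> exp_ge_add_one_self[of "2 * \<beta>"] by (intro mult_right_mono) auto
    also have "\<dots> = (exp \<beta>)\<^sup>2 * (1 - \<beta>)" by (simp add: exp_double)
    finally have "sqrt 1 \<le> sqrt ((exp \<beta>)\<^sup>2 * (1 - \<beta>))" by (rule real_sqrt_le_mono)
    also have "\<dots> = exp \<beta> * sqrt (1 - \<beta>)" by (simp add: real_sqrt_mult)
    finally show ?thesis using \<beta> by (simp add: field_simps)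
  qed
  then have le: "exp z / sqrt (1 - \<beta>) \<le> exp (z + \<beta>)" for z
    using mult_left_mono[of "1 / sqrt (1 - \<beta>)" "exp \<beta>" "exp z"] by (simp add: exp_add)
  have \<kappa>: "\<kappa> / (2 * (1 - \<beta>)) \<le> N\<^sup>2 * m * (l * t)\<^sup>2"
  proof -
    have "\<kappa> / (2 * (1 - \<beta>)) \<le> \<kappa> / 1"
      using \<beta> mN by (intro divide_left_mono) (auto simp: \<kappa>_def)
    also have "(1 - l * m)\<^sup>2 \<le> 1" using lm by (simp add: power_le_one)
    then have "(l * t)\<^sup>2 * (1 - l * m)\<^sup>2 \<le> (l * t)\<^sup>2 * 1" by (rule mult_left_mono) simp
    then have "\<kappa> / 1 \<le> N\<^sup>2 * m * (l * t)\<^sup>2"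
      unfolding \<kappa>_def using mN by (simp add: power_mult_distrib mult_left_mono)
    finally show ?thesis .
  qed
  have "- l * m * N * t\<^sup>2 + l\<^sup>2 * m\<^sup>2 * N * t\<^sup>2 / 2 + \<kappa> / (2 * (1 - \<beta>)) + \<beta>
      \<le> - l * m * N * t\<^sup>2 + l\<^sup>2 * m\<^sup>2 * N * t\<^sup>2 + N\<^sup>2 * m * (l * t)\<^sup>2 + \<beta>"
  proof -
    have "0 \<le> l\<^sup>2 * m\<^sup>2 * N * t\<^sup>2" using mN by simp
    with \<kappa> show ?thesis by linarith
  qed
  also have "\<dots> = - (m * N) * (l * t\<^sup>2 - l\<^sup>2 * (n * t\<^sup>2 + 1))"
    unfolding mN(1)[symmetric] \<beta>_def by (simp add: power2_eq_square algebra_simps)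
  finally have expo: "- l * m * N * t\<^sup>2 + l\<^sup>2 * m\<^sup>2 * N * t\<^sup>2 / 2 + \<kappa> / (2 * (1 - \<beta>)) + \<beta>
      \<le> - (m * N) * (l * t\<^sup>2 - l\<^sup>2 * (n * t\<^sup>2 + 1))" .
  have "(\<integral>\<^sup>+x. ennreal (exp (- l * ((\<Sum>i\<in>{..<n} - T. t + e i * x i) * (\<Sum>i\<in>T. t + e i * x i)))) \<partial>(\<Pi>\<^sub>M i\<in>{..<n}. \<gamma>))
      = ennreal (exp (- l * m * N * t\<^sup>2 + l\<^sup>2 * m\<^sup>2 * N * t\<^sup>2 / 2 + \<kappa> / (2 * (1 - \<beta>))) / sqrt (1 - \<beta>))"
    unfolding m_def N_def \<beta>_def \<kappa>_def
    using \<beta>(2) T e l(1) by (intro nn_integral_exp_product_of_sums) (auto simp: \<beta>_def m_def N_def)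
  also have "\<dots> \<le> ennreal (exp (- (m * N) * (l * t\<^sup>2 - l\<^sup>2 * (n * t\<^sup>2 + 1))))"
    using le expo by (intro ennreal_leI) (meson exp_le_cancel_iff order_trans)
  finally show ?thesis .
qed

text \<open>
  The inner product of the sums of the vectors \<open>t + \<eta> i * \<xi> i\<close> over \<open>T\<close> and over its complement. For
  \<open>t = \<theta> / \<sigma>\<close> these vectors are the observations with their labels removed, in units of \<open>\<sigma>\<close>.
\<close>

definition block_product :: "nat \<Rightarrow> nat \<Rightarrow> (nat \<Rightarrow> real) \<Rightarrow> (nat \<Rightarrow> real) \<Rightarrow> nat set \<Rightarrow> (nat \<Rightarrow> nat \<Rightarrow> real) \<Rightarrow> real" where
  "block_product n p t \<eta> T \<xi> =
    (\<Sum>k<p. (\<Sum>i\<in>{..<n} - T. t k + \<eta> i * \<xi> i k) * (\<Sum>i\<in>T. t k + \<eta> i * \<xi> i k))"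

lemma measurable_block_product:
  assumes "T \<subseteq> {..<n}"
  shows "block_product n p t \<eta> T \<in> borel_measurable (noise n p)"
  unfolding block_product_def[abs_def] using assms
  by (intro borel_measurable_sum borel_measurable_times borel_measurable_add borel_measurable_const
        measurable_noise_entry) auto

text \<open>
  The inner product has mean \<open>m * N * S\<close>, where \<open>m\<close> and \<open>N\<close> are the sizes of the two blocks. The bound is the
  exponential Markov inequality; \<open>l = S / (2 * (n * S + p))\<close> maximises \<open>l * S - l\<^sup>2 * (n * S + p)\<close>,
  which is minus the sum of the exponents of the coordinates divided by \<open>m * N\<close>, and is small enough for the estimate of each coordinate.
\<close>

lemma prob_block_product_le:
  fixes t :: "nat \<Rightarrow> real" and n p :: nat
  assumes T: "T \<subseteq> {..<n}" and \<eta>: "\<eta> \<in> labels n" and half: "2 * card T \<le> n" and "n > 0" "p > 0"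
  defines "S \<equiv> \<Sum>k<p. (t k)\<^sup>2"
  shows "measure (noise n p) {\<xi> \<in> space (noise n p). block_product n p t \<eta> T \<xi> \<le> 0}
    \<le> exp (- (card T * (S\<^sup>2 / (8 * (S + p / n)))))"
proof -
  interpret prob_space "noise n p" by (rule prob_space_noise)
  define m N where "m = real (card T)" and "N = real (card ({..<n} - T))"
  define l where "l = S / (2 * (n * S + p))"
  have N: "N = n - m" "2 * N \<ge> n" "m \<ge> 0"
    using T half card_mono[OF _ T] by (auto simp: m_def N_def card_Diff_subset finite_subset of_nat_diff)
  have S: "S \<ge> 0" by (auto simp: S_def intro: sum_nonneg)
  have D: "n * S + p > 0" using S assms(4,5) by (intro add_nonneg_pos) auto
  have l: "0 \<le> l" "2 * real n * l \<le> 1" using S D by (auto simp: l_def field_simps)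
  define f where "f k x = ennreal (exp (- l * ((\<Sum>i\<in>{..<n} - T. t k + \<eta> i * x i) * (\<Sum>i\<in>T. t k + \<eta> i * x i))))"
    for k and x :: "nat \<Rightarrow> real"
  have f_measurable: "f k \<in> borel_measurable (\<Pi>\<^sub>M i\<in>{..<n}. \<gamma>)" for k
  proof -
    have "(\<lambda>x. x i) \<in> borel_measurable (\<Pi>\<^sub>M i\<in>{..<n}. \<gamma>)" if "i < n" for i
      using measurable_component_singleton[of i "{..<n}" "\<lambda>_. \<gamma>"] that by simp
    with T show ?thesis
      unfolding f_def[abs_def]
      by (intro measurable_compose[OF _ measurable_ennreal] measurable_compose[OF _ borel_measurable_exp]
            borel_measurable_times borel_measurable_const borel_measurable_sum borel_measurable_add) auto
  qed
  have "emeasure (noise n p) {\<xi> \<in> space (noise n p). block_product n p t \<eta> T \<xi> \<le> 0}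
      = (\<integral>\<^sup>+\<xi>. indicator {\<xi> \<in> space (noise n p). block_product n p t \<eta> T \<xi> \<le> 0} \<xi> \<partial>noise n p)"
    using measurable_block_product[OF T] by (subst nn_integral_indicator) auto
  also have "\<dots> \<le> (\<integral>\<^sup>+\<xi>. (\<Prod>k<p. f k (\<lambda>i\<in>{..<n}. \<xi> i k)) \<partial>noise n p)"
  proof (rule nn_integral_mono)
    fix \<xi>
    have "(\<Prod>k<p. f k (\<lambda>i\<in>{..<n}. \<xi> i k)) = (\<Prod>k<p. ennreal (exp (- l * ((\<Sum>i\<in>{..<n} - T. t k + \<eta> i * \<xi> i k) * (\<Sum>i\<in>T. t k + \<eta> i * \<xi> i k)))))"
      unfolding f_def using T
      by (intro prod.cong refl arg_cong[where f="\<lambda>u. ennreal (exp (- l * u))"] arg_cong2[where f="(*)"] sum.cong) auto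
    also have "\<dots> = ennreal (exp (- l * block_product n p t \<eta> T \<xi>))"
      by (simp add: prod_ennreal exp_sum[symmetric] block_product_def sum_distrib_left sum_negf)
    finally show "indicator {\<xi> \<in> space (noise n p). block_product n p t \<eta> T \<xi> \<le> 0} \<xi>
        \<le> (\<Prod>k<p. f k (\<lambda>i\<in>{..<n}. \<xi> i k))"
      using l by (auto simp: indicator_def mult_nonneg_nonpos intro!: ennreal_leI)
  qed
  also have "\<dots> = (\<Prod>k<p. \<integral>\<^sup>+x. f k x \<partial>(\<Pi>\<^sub>M i\<in>{..<n}. \<gamma>))"
    unfolding noise_def using f_measurable
    by (intro nn_integral_PiM_PiM_transpose) (auto intro: prob_space_imp_sigma_finite prob_space_std_normal)
  also have "\<dots> \<le> (\<Prod>k<p. ennreal (exp (- (m * N) * (l * (t k)\<^sup>2 - l\<^sup>2 * (n * (t k)\<^sup>2 + 1)))))"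
    unfolding f_def m_def N_def
    using l label_eq[OF \<eta>] by (intro prod_mono_ennreal coordinate_chernoff T l \<open>n > 0\<close>) auto
  also have "\<dots> = ennreal (exp (\<Sum>k<p. - (m * N) * (l * (t k)\<^sup>2 - l\<^sup>2 * (n * (t k)\<^sup>2 + 1))))"
    by (simp add: prod_ennreal exp_sum)
  also have "(\<Sum>k<p. - (m * N) * (l * (t k)\<^sup>2 - l\<^sup>2 * (n * (t k)\<^sup>2 + 1)))
      = - (m * N) * (l * S - l\<^sup>2 * (n * S + p))"
    by (simp only: sum_distrib_left[symmetric] sum_subtractf sum.distrib S_def sum_constant card_lessThan
          mult_1_right)
  also have "l * S - l\<^sup>2 * (n * S + p) = S\<^sup>2 / (4 * (n * S + p))"
  proof -
    have "S / (2 * d) * S - (S / (2 * d))\<^sup>2 * d = S\<^sup>2 / (4 * d)" if "d > 0" for d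
      using that by (simp add: power2_eq_square field_simps)
    from this[OF D] show ?thesis by (simp only: l_def)
  qed
  also have "ennreal (exp (- (m * N) * (S\<^sup>2 / (4 * (n * S + p)))))
      \<le> ennreal (exp (- (card T * (S\<^sup>2 / (8 * (S + p / n))))))"
  proof (intro ennreal_leI)
    have "S\<^sup>2 / (8 * (S + p / n)) = n / 2 * (S\<^sup>2 / (4 * (n * S + p)))"
      using D \<open>n > 0\<close> by (simp add: field_simps)
    also have "\<dots> \<le> N * (S\<^sup>2 / (4 * (n * S + p)))"
      using N D by (intro mult_right_mono) auto
    finally have "m * (S\<^sup>2 / (8 * (S + p / n))) \<le> m * (N * (S\<^sup>2 / (4 * (n * S + p))))"
      using N by (intro mult_left_mono) auto
    then show "exp (- (m * N) * (S\<^sup>2 / (4 * (n * S + p)))) \<le> exp (- (card T * (S\<^sup>2 / (8 * (S + p / n)))))"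
      by (simp add: m_def mult_ac)
  qed
  finally show ?thesis
    by (simp add: emeasure_eq_measure)
qed

text \<open>
  The squared norm of \<open>Y\<close> applied to \<open>\<eta>\<close>, which the maximum likelihood estimator of the labels maximises.
\<close>

definition fit :: "nat \<Rightarrow> nat \<Rightarrow> (nat \<Rightarrow> real) \<Rightarrow> (nat \<Rightarrow> nat \<Rightarrow> real) \<Rightarrow> real" where
  "fit n p \<eta> Y = (\<Sum>k<p. (\<Sum>i<n. \<eta> i * Y i k)\<^sup>2)"

text \<open>
  Let \<open>A\<close> and \<open>B\<close> be the sums of the observations with their labels removed, over the correct and the wrong labels
  of \<open>\<eta>'\<close>. The fits of \<open>\<eta>\<close> and \<open>\<eta>'\<close> are proportional to the squared norms of \<open>A + B\<close> and
  \<open>A - B\<close>, so the second fit is at least the first precisely if the inner product of \<open>A\<close> and \<open>B\<close> is not positive. This condition is symmetric in the two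
  blocks, and \<open>T\<close> is the smaller of them.
\<close>

lemma error_block_of_better_fit:
  assumes "\<sigma> > 0" "\<eta> \<in> labels n" "\<eta>' \<in> labels n"
    and better: "fit n p \<eta> (observation n p \<sigma> \<theta> \<eta> \<xi>) \<le> fit n p \<eta>' (observation n p \<sigma> \<theta> \<eta> \<xi>)"
  obtains T where "T \<subseteq> {..<n}" "2 * card T \<le> n" "loss n \<eta>' \<eta> = 2 * card T"
    "block_product n p (\<lambda>k. \<theta> k / \<sigma>) \<eta> T \<xi> \<le> 0"
proof -
  define W where "W = {i \<in> {..<n}. \<eta>' i \<noteq> \<eta> i}"
  have W: "W \<subseteq> {..<n}" "finite W" by (auto simp: W_def)
  define t where "t k = \<theta> k / \<sigma>" for k
  define A B where "A k = (\<Sum>i\<in>{..<n} - W. t k + \<eta> i * \<xi> i k)" and "B k = (\<Sum>i\<in>W. t k + \<eta> i * \<xi> i k)" for k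
  have split: "(\<Sum>i<n. g i) = (\<Sum>i\<in>{..<n} - W. g i) + (\<Sum>i\<in>W. g i)" for g :: "nat \<Rightarrow> real"
    using W by (intro sum.subset_diff) auto
  have entry: "\<eta> i * observation n p \<sigma> \<theta> \<eta> \<xi> i k = \<sigma> * (t k + \<eta> i * \<xi> i k)" if "i < n" "k < p" for i k
    using that label_eq[OF assms(2) \<open>i < n\<close>] \<open>\<sigma> > 0\<close> by (auto simp: observation_def t_def field_simps)
  have on: "\<eta>' i = \<eta> i" if "i \<in> {..<n} - W" for i using that by (auto simp: W_def)
  have off: "\<eta>' i = - \<eta> i" if "i \<in> W" for i
    using that label_eq[OF assms(2), of i] label_eq[OF assms(3), of i] by (auto simp: W_def)
  have true_fit: "(\<Sum>i<n. \<eta> i * observation n p \<sigma> \<theta> \<eta> \<xi> i k) = \<sigma> * (A k + B k)" if "k < p" for k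
    using that by (simp add: entry sum_distrib_left[symmetric] split A_def B_def)
  have est_fit: "(\<Sum>i<n. \<eta>' i * observation n p \<sigma> \<theta> \<eta> \<xi> i k) = \<sigma> * (A k - B k)" if "k < p" for k
  proof -
    have "(\<Sum>i\<in>{..<n} - W. \<eta>' i * observation n p \<sigma> \<theta> \<eta> \<xi> i k) = (\<Sum>i\<in>{..<n} - W. \<sigma> * (t k + \<eta> i * \<xi> i k))"
      using that on by (intro sum.cong) (auto simp: entry)
    moreover have "(\<Sum>i\<in>W. \<eta>' i * observation n p \<sigma> \<theta> \<eta> \<xi> i k) = (\<Sum>i\<in>W. - (\<sigma> * (t k + \<eta> i * \<xi> i k)))"
      using that off W by (intro sum.cong) (auto simp: entry[symmetric])
    ultimately show ?thesis
      by (simp add: split A_def B_def sum_negf sum_distrib_left[symmetric] right_diff_distrib)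
  qed
  have "0 \<le> fit n p \<eta>' (observation n p \<sigma> \<theta> \<eta> \<xi>) - fit n p \<eta> (observation n p \<sigma> \<theta> \<eta> \<xi>)"
    using better by simp
  also have "\<dots> = (\<Sum>k<p. (\<sigma> * (A k - B k))\<^sup>2 - (\<sigma> * (A k + B k))\<^sup>2)"
    by (simp add: fit_def true_fit est_fit sum_subtractf)
  also have "\<dots> = (\<Sum>k<p. - 4 * \<sigma>\<^sup>2 * (A k * B k))"
    by (intro sum.cong refl) (simp add: power2_eq_square algebra_simps)
  also have "\<dots> = - (4 * \<sigma>\<^sup>2 * (\<Sum>k<p. A k * B k))"
    by (simp add: sum_distrib_left[symmetric] sum_negf)
  finally have AB: "(\<Sum>k<p. A k * B k) \<le> 0"
    using \<open>\<sigma> > 0\<close> by (simp add: mult_le_0_iff)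
  have card: "card ({..<n} - W) + card W = n"
    using W card_mono[OF _ W(1)] by (simp add: card_Diff_subset)
  have corr: "(\<Sum>j<n. \<eta>' j * \<eta> j) = real (card ({..<n} - W)) - card W"
  proof -
    have "(\<Sum>j\<in>{..<n} - W. \<eta>' j * \<eta> j) = (\<Sum>j\<in>{..<n} - W. 1)"
      using label_eq[OF assms(2)] by (intro sum.cong refl) (force simp: on)
    moreover have "(\<Sum>j\<in>W. \<eta>' j * \<eta> j) = (\<Sum>j\<in>W. - 1)"
      using label_eq[OF assms(2)] W by (intro sum.cong refl) (force simp: off)
    ultimately show ?thesis by (simp add: split)
  qed
  show thesis
  proof (cases "2 * card W \<le> n")
    case True
    have "loss n \<eta>' \<eta> = 2 * card W"
      using True card unfolding loss_eq[OF assms(3,2)] corr by linarith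
    with W True AB show thesis
      by (intro that[of W]) (auto simp: block_product_def A_def B_def t_def)
  next
    case False
    have "loss n \<eta>' \<eta> = 2 * card ({..<n} - W)"
      using False card unfolding loss_eq[OF assms(3,2)] corr by linarith
    moreover have "{..<n} - ({..<n} - W) = W" using W by auto
    ultimately show thesis
      using False AB card
      by (intro that[of "{..<n} - W"]) (auto simp: block_product_def A_def B_def t_def mult.commute)
  qed
qed

lemma binomial_le_exp_power:
  assumes "m > 0"
  shows "real (n choose m) \<le> (exp 1 * n / m) ^ m"
proof -
  have "real m ^ m / fact m \<le> exp (real m)"
    using sum_le_suminf[OF summable_exp, of "{m}" "real m"] exp_def by (simp add: exp_def field_simps)
  then have fact: "real m ^ m \<le> exp 1 ^ m * fact m"
    by (simp add: exp_of_nat_mult[symmetric] field_simps)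
  have "real (n choose m) * fact m \<le> real n ^ m"
    using binomial_fact_pow[of n m] by (metis of_nat_fact of_nat_le_iff of_nat_mult of_nat_power)
  then have "real (n choose m) * real m ^ m \<le> exp 1 ^ m * real n ^ m"
    using fact by (smt (verit) mult.assoc mult.commute mult_left_mono of_nat_0_le_iff zero_le_power exp_gt_zero)
  then show ?thesis using assms by (simp add: power_mult_distrib power_divide field_simps)
qed

text \<open>
  There are at most \<open>(exp 1 * n / m) ^ m\<close> blocks of size \<open>m\<close>. Once \<open>m\<close> exceeds \<open>2 * exp 1 * u * n\<close>, each of the
  \<open>m\<close> factors \<open>exp 1 * n / m * u\<^sup>2\<close> is at most \<open>u / 2\<close>: half of the exponent pays for the choice of the block, and
  the other half is left over to sum to \<open>u\<close>.
\<close>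

lemma sum_large_blocks_le:
  fixes u :: real and n :: nat
  assumes u: "0 < u" "u \<le> 1" and "n > 0"
  shows "(\<Sum>T | T \<subseteq> {..<n} \<and> 2 * exp 1 * u * n < card T. (u\<^sup>2) ^ card T) \<le> u"
proof -
  define \<T> where "\<T> = {T. T \<subseteq> {..<n} \<and> 2 * exp 1 * u * n < card T}"
  have fin: "finite \<T>" unfolding \<T>_def by (rule finite_subset[of _ "Pow {..<n}"]) (auto intro: finite_lessThan)
  have layer: "(\<Sum>T | T \<in> \<T> \<and> card T = m. (u\<^sup>2) ^ card T) \<le> u * (1 / 2) ^ m" if m: "m \<in> {1..n}" for m
  proof (cases "2 * exp 1 * u * n < m")
    case True
    have "(\<Sum>T | T \<in> \<T> \<and> card T = m. (u\<^sup>2) ^ card T) \<le> (\<Sum>T | T \<subseteq> {..<n} \<and> card T = m. (u\<^sup>2) ^ card T)"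
      by (rule sum_mono2) (auto simp: \<T>_def intro: finite_subset[of _ "Pow {..<n}"])
    also have "\<dots> = (n choose m) * (u\<^sup>2) ^ m"
      using n_subsets[of "{..<n}" m] by simp
    also have "\<dots> \<le> (exp 1 * n / m) ^ m * (u\<^sup>2) ^ m"
      using m by (intro mult_right_mono binomial_le_exp_power) auto
    also have "\<dots> = (exp 1 * n / m * u\<^sup>2) ^ m" by (simp only: power_mult_distrib)
    also have "\<dots> \<le> (u * (1 / 2)) ^ m"
    proof (rule power_mono)
      have "u * (2 * exp 1 * u * n) \<le> u * m" using True u by (intro mult_left_mono) auto
      then show "exp 1 * n / m * u\<^sup>2 \<le> u * (1 / 2)"
        using m by (simp add: field_simps power2_eq_square)
    qed (use u in auto)
    also have "\<dots> \<le> u * (1 / 2) ^ m"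
      using u m power_decreasing[of 1 m u] by (auto simp: power_mult_distrib power_divide intro!: divide_right_mono)
    finally show ?thesis .
  next
    case False
    then have "{T \<in> \<T>. card T = m} = {}" by (auto simp: \<T>_def)
    then show ?thesis by (simp only: sum.empty) (use u in simp)
  qed
  have "card ` \<T> \<subseteq> {1..n}"
  proof safe
    fix T assume T: "T \<in> \<T>"
    have "0 \<le> 2 * exp 1 * u * n" using u by simp
    also have "\<dots> < card T" using T by (simp add: \<T>_def)
    finally have "0 < card T" by simp
    with T show "card T \<in> {1..n}" using card_mono[of "{..<n}" T] by (auto simp: \<T>_def)
  qed
  then have "(\<Sum>T\<in>\<T>. (u\<^sup>2) ^ card T) = (\<Sum>m\<in>{1..n}. \<Sum>T | T \<in> \<T> \<and> card T = m. (u\<^sup>2) ^ card T)"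
    using fin by (intro sum.group[symmetric]) auto
  also have "\<dots> \<le> (\<Sum>m\<in>{1..n}. u * (1 / 2) ^ m)" by (rule sum_mono) (rule layer)
  also have "\<dots> = u * (1 - (1 / 2) ^ n)"
  proof -
    have "(\<Sum>m\<in>{1..n}. (1 / 2 :: real) ^ m) = 1 - (1 / 2) ^ n" by (induction n) (auto simp: field_simps)
    then show ?thesis by (simp add: sum_distrib_left[symmetric])
  qed
  also have "\<dots> \<le> u" using u by (simp add: mult_left_le)
  finally show ?thesis by (simp add: \<T>_def)
qed

text \<open>
  Error blocks with at most \<open>2 * exp 1 * u * n\<close> elements contribute at most \<open>4 * exp 1 * u\<close> to the risk, and all
  larger ones together at most \<open>u\<close> by the union bound. A centre longer than \<open>\<Delta>\<close> only helps, as
  \<open>S\<^sup>2 / (S + p / n)\<close> increases with \<open>S\<close>.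
\<close>

lemma best_fit_risk_le:
  assumes est: "est \<in> estimators n p"
    and best: "\<And>Y \<eta>. Y \<in> space (obs_space n p) \<Longrightarrow> \<eta> \<in> labels n \<Longrightarrow> fit n p \<eta> Y \<le> fit n p (est Y) Y"
    and "n > 0" "p > 0" "\<sigma> > 0" "\<Delta> > 0" and param: "(\<theta>, \<eta>) \<in> params n p \<Delta>"
  shows "risk n p \<sigma> est \<theta> \<eta> \<le> (4 * exp 1 + 1) * exp (- (snr n p \<sigma> \<Delta>)\<^sup>2 / 16)"
proof -
  define u where "u = exp (- (snr n p \<sigma> \<Delta>)\<^sup>2 / 16)"
  have u: "0 < u" "u \<le> 1" by (auto simp: u_def)
  have u2: "u\<^sup>2 = exp (- ((snr n p \<sigma> \<Delta>)\<^sup>2 / 8))" by (simp add: u_def exp_double[symmetric])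
  have \<eta>: "\<eta> \<in> labels n" and \<theta>: "L2_set \<theta> {..<p} \<ge> \<Delta>" using param by (auto simp: params_def)
  interpret prob_space "noise n p" by (rule prob_space_noise)
  define t where "t k = \<theta> k / \<sigma>" for k
  define S where "S = (\<Sum>k<p. (t k)\<^sup>2)"
  define s where "s = \<Delta>\<^sup>2 / \<sigma>\<^sup>2"
  define G where "G T = {\<xi> \<in> space (noise n p). block_product n p t \<eta> T \<xi> \<le> 0}" for T
  have s: "s > 0" using assms by (simp add: s_def)
  have "\<Delta>\<^sup>2 \<le> (L2_set \<theta> {..<p})\<^sup>2" using \<theta> \<open>\<Delta> > 0\<close> by (intro power_mono) auto
  then have "\<Delta>\<^sup>2 / \<sigma>\<^sup>2 \<le> (\<Sum>k<p. (\<theta> k)\<^sup>2) / \<sigma>\<^sup>2"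
    by (intro divide_right_mono) (auto simp: L2_set_def sum_nonneg)
  then have sS: "s \<le> S" by (simp add: s_def S_def t_def power_divide sum_divide_distrib)
  have snr_le: "(snr n p \<sigma> \<Delta>)\<^sup>2 / 8 \<le> S\<^sup>2 / (8 * (S + p / n))"
  proof -
    have "(snr n p \<sigma> \<Delta>)\<^sup>2 = s\<^sup>2 / (s + p / n)"
      using s by (simp add: snr_def s_def[symmetric] power_divide)
    also have "\<dots> \<le> S\<^sup>2 / (S + p / n)"
    proof -
      have "s * s * (S + p / n) \<le> S * S * (s + p / n)"
      proof -
        have "s * S * s \<le> s * S * S" using s sS by (intro mult_left_mono) auto
        moreover have "s * s * (p / n) \<le> S * S * (p / n)" using s sS by (intro mult_mono) auto
        ultimately show ?thesis by (simp add: algebra_simps)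
      qed
      moreover have "s + p / n > 0" "S + p / n > 0" using s sS by (auto intro: add_pos_nonneg)
      ultimately show ?thesis by (simp add: divide_le_eq le_divide_eq power2_eq_square mult_ac pos_divide_le_eq pos_le_divide_eq)
    qed
    finally have "(snr n p \<sigma> \<Delta>)\<^sup>2 \<le> S\<^sup>2 / (S + p / n)" .
    then have "(snr n p \<sigma> \<Delta>)\<^sup>2 / 8 \<le> S\<^sup>2 / (S + p / n) / 8" by (rule divide_right_mono) simp
    moreover have "S\<^sup>2 / (8 * (S + p / n)) = S\<^sup>2 / (S + p / n) / 8"
      by (simp only: divide_divide_eq_left mult.commute)
    ultimately show ?thesis by (simp only:)
  qed
  have prob_G: "prob (G T) \<le> (u\<^sup>2) ^ card T" if T: "T \<subseteq> {..<n}" "2 * card T \<le> n" for T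
  proof -
    have "prob (G T) \<le> exp (- (card T * (S\<^sup>2 / (8 * (S + p / n)))))"
      unfolding G_def S_def using T \<eta> assms by (intro prob_block_product_le) auto
    also have "\<dots> \<le> exp (- (card T * ((snr n p \<sigma> \<Delta>)\<^sup>2 / 8)))"
      unfolding exp_le_cancel_iff neg_le_iff_le using snr_le by (rule mult_left_mono) simp
    also have "\<dots> = (u\<^sup>2) ^ card T" by (simp add: u2 exp_of_nat_mult[symmetric])
    finally show ?thesis .
  qed
  define \<T> where "\<T> = {T. T \<subseteq> {..<n} \<and> 2 * card T \<le> n \<and> 2 * exp 1 * u * n < card T}"
  have fin: "finite \<T>" unfolding \<T>_def by (rule finite_subset[of _ "Pow {..<n}"]) (auto intro: finite_lessThan)
  have G_sets: "G T \<in> sets (noise n p)" if "T \<in> \<T>" for T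
    using measurable_block_product[of T n p t \<eta>] that unfolding G_def \<T>_def by auto
  have loss_le: "loss n (est (observation n p \<sigma> \<theta> \<eta> \<xi>)) \<eta>
      \<le> 4 * exp 1 * u * n + (\<Sum>T\<in>\<T>. real n * indicator (G T) \<xi>)" if \<xi>: "\<xi> \<in> space (noise n p)" for \<xi>
  proof -
    define Y where "Y = observation n p \<sigma> \<theta> \<eta> \<xi>"
    have Y: "Y \<in> space (obs_space n p)"
      unfolding Y_def using \<xi> by (rule measurable_space[OF measurable_observation])
    obtain T where T: "T \<subseteq> {..<n}" "2 * card T \<le> n" "loss n (est Y) \<eta> = 2 * card T" "\<xi> \<in> G T"
      using error_block_of_better_fit[OF \<open>\<sigma> > 0\<close> \<eta> estimator_in_labels[OF est Y], of p \<theta> \<xi>]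
        best[OF Y \<eta>] \<xi> unfolding Y_def G_def t_def[abs_def] by auto
    show ?thesis
    proof (cases "T \<in> \<T>")
      case True
      have "loss n (est Y) \<eta> \<le> real n * indicator (G T) \<xi>" using T by simp
      also have "\<dots> \<le> (\<Sum>T\<in>\<T>. real n * indicator (G T) \<xi>)"
        using fin True by (intro member_le_sum) auto
      finally show ?thesis using u unfolding Y_def by (simp add: add_increasing)
    next
      case False
      then have "card T \<le> 2 * exp 1 * u * n" using T by (simp add: \<T>_def not_less)
      then have "loss n (est Y) \<eta> \<le> 4 * exp 1 * u * n" using T(3) by linarith
      moreover have "0 \<le> (\<Sum>T\<in>\<T>. real n * indicator (G T) \<xi> :: real)" by (intro sum_nonneg) auto
      ultimately show ?thesis unfolding Y_def by linarith
    qed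
  qed
  have int_G: "integrable (noise n p) (indicator (G T) :: _ \<Rightarrow> real)" if "T \<in> \<T>" for T
    using G_sets[OF that] by (intro integrable_real_indicator) (auto simp: emeasure_eq_measure)
  have "(\<integral>Y. loss n (est Y) \<eta> \<partial>obs_law n p \<sigma> \<theta> \<eta>)
      = (\<integral>\<xi>. loss n (est (observation n p \<sigma> \<theta> \<eta> \<xi>)) \<eta> \<partial>noise n p)"
    unfolding obs_law_def
    by (rule integral_distr[OF measurable_observation measurable_estimator_compose[OF est]]) simp
  also have "\<dots> \<le> (\<integral>\<xi>. 4 * exp 1 * u * n + (\<Sum>T\<in>\<T>. real n * indicator (G T) \<xi>) \<partial>noise n p)"
  proof (rule integral_mono)
    show "integrable (noise n p) (\<lambda>\<xi>. loss n (est (observation n p \<sigma> \<theta> \<eta> \<xi>)) \<eta>)"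
      using integrable_loss[OF est \<eta>, of \<sigma> \<theta> \<eta>] unfolding obs_law_def
      by (rule integrable_distr[OF measurable_observation])
    show "integrable (noise n p) (\<lambda>\<xi>. 4 * exp 1 * u * n + (\<Sum>T\<in>\<T>. real n * indicator (G T) \<xi>))"
      by (intro Bochner_Integration.integrable_add Bochner_Integration.integrable_sum integrable_mult_right int_G) auto
  qed (rule loss_le)
  also have "\<dots> = 4 * exp 1 * u * n + (\<Sum>T\<in>\<T>. real n * prob (G T))"
    using int_G G_sets
    by (subst Bochner_Integration.integral_add)
       (auto simp: Bochner_Integration.integral_sum prob_space G_def intro!: Bochner_Integration.integrable_sum sum.cong)
  also have "\<dots> \<le> 4 * exp 1 * u * n + n * u"
  proof -
    have "(\<Sum>T\<in>\<T>. prob (G T)) \<le> (\<Sum>T\<in>\<T>. (u\<^sup>2) ^ card T)"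
      by (intro sum_mono prob_G) (auto simp: \<T>_def)
    also have "\<dots> \<le> (\<Sum>T | T \<subseteq> {..<n} \<and> 2 * exp 1 * u * n < card T. (u\<^sup>2) ^ card T)"
      by (rule sum_mono2) (auto simp: \<T>_def intro: finite_subset[of _ "Pow {..<n}"])
    also have "\<dots> \<le> u" by (rule sum_large_blocks_le[OF u \<open>n > 0\<close>])
    finally have "n * (\<Sum>T\<in>\<T>. prob (G T)) \<le> n * u" by (rule mult_left_mono) simp
    then show ?thesis by (simp add: sum_distrib_left)
  qed
  finally have "(\<integral>Y. loss n (est Y) \<eta> \<partial>obs_law n p \<sigma> \<theta> \<eta>) \<le> 4 * exp 1 * u * n + n * u" .
  then show ?thesis
    using \<open>n > 0\<close> unfolding risk_def u_def[symmetric] by (simp add: field_simps)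
qed

lemma minimax_risk_le:
  assumes "n > 0" "p > 0" "\<sigma> > 0" "\<Delta> > 0"
  shows "minimax_risk n p \<sigma> \<Delta> \<le> (4 * exp 1 + 1) * exp (- (snr n p \<sigma> \<Delta>)\<^sup>2 / 16)"
proof -
  have "fit n p \<eta> \<in> borel_measurable (obs_space n p)" for \<eta>
    unfolding fit_def[abs_def]
    by (intro borel_measurable_sum borel_measurable_power borel_measurable_times borel_measurable_const
          measurable_obs_entry) auto
  with ex_measurable_argmax[OF finite_labels labels_nonempty, of n "fit n p" "obs_space n p"]
  obtain est where est: "est \<in> estimators n p"
    and best: "\<And>Y \<eta>. Y \<in> space (obs_space n p) \<Longrightarrow> \<eta> \<in> labels n \<Longrightarrow> fit n p \<eta> Y \<le> fit n p (est Y) Y"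
    unfolding estimators_def by blast
  obtain \<eta> where \<eta>: "\<eta> \<in> labels n" using labels_nonempty by auto
  have "(\<lambda>k\<in>{..<p}. \<Delta>, \<eta>) \<in> params n p \<Delta>"
  proof -
    have "\<Delta> = L2_set (\<lambda>k\<in>{..<p}. \<Delta>) {0}"
      using assms by (simp add: L2_set_def)
    also have "\<dots> \<le> L2_set (\<lambda>k\<in>{..<p}. \<Delta>) {..<p}"
      unfolding L2_set_def using assms by (intro real_sqrt_le_mono sum_mono2) auto
    finally show ?thesis using \<eta> by (auto simp: params_def)
  qed
  then obtain \<theta>0 \<eta>0 where param: "(\<theta>0, \<eta>0) \<in> params n p \<Delta>" by blast
  have "minimax_risk n p \<sigma> \<Delta> \<le> (SUP (\<theta>, \<eta>)\<in>params n p \<Delta>. risk n p \<sigma> est \<theta> \<eta>)"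
    unfolding minimax_risk_eq
  proof (rule cINF_lower[OF _ est])
    have "0 \<le> (SUP (\<theta>, \<eta>)\<in>params n p \<Delta>. risk n p \<sigma> est' \<theta> \<eta>)" if "est' \<in> estimators n p" for est'
      using risk_bounds(1)[OF that, of \<eta>0 \<sigma> \<theta>0] risk_le_worst_risk[OF that param, of \<sigma>] param
      by (auto simp: params_def)
    then show "bdd_below ((\<lambda>est. SUP (\<theta>, \<eta>)\<in>params n p \<Delta>. risk n p \<sigma> est \<theta> \<eta>) ` estimators n p)"
      unfolding bdd_below_def by (intro exI[of _ 0]) blast
  qed
  also have "\<dots> \<le> (4 * exp 1 + 1) * exp (- (snr n p \<sigma> \<Delta>)\<^sup>2 / 16)"
  proof (rule cSUP_least)
    show "params n p \<Delta> \<noteq> {}" using param by blast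
    fix x assume "x \<in> params n p \<Delta>"
    then show "(case x of (\<theta>, \<eta>) \<Rightarrow> risk n p \<sigma> est \<theta> \<eta>) \<le> (4 * exp 1 + 1) * exp (- (snr n p \<sigma> \<Delta>)\<^sup>2 / 16)"
      using best_fit_risk_le[OF est best assms] by (cases x) simp
  qed
  finally show ?thesis .
qed

theorem proposition4:
  "\<exists>c1 c2 C1 C2 :: real. 0 < c1 \<and> 0 < c2 \<and> 0 < C1 \<and> 0 < C2 \<and>
     (\<forall>(p :: nat \<Rightarrow> nat) (\<sigma> :: nat \<Rightarrow> real) (\<Delta> :: nat \<Rightarrow> real).
        (\<forall>n. 0 < p n \<and> 0 < \<sigma> n \<and> 0 < \<Delta> n) \<longrightarrow>
        (\<forall>\<^sub>F n in sequentially.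
           C1 * exp (- c1 * (snr n (p n) (\<sigma> n) (\<Delta> n))\<^sup>2) \<le> minimax_risk n (p n) (\<sigma> n) (\<Delta> n) \<and>
           minimax_risk n (p n) (\<sigma> n) (\<Delta> n) \<le> C2 * exp (- c2 * (snr n (p n) (\<sigma> n) (\<Delta> n))\<^sup>2)))"
proof (rule exI[of _ 4], rule exI[of _ "1 / 16"], rule exI[of _ "1 / 8"], rule exI[of _ "4 * exp 1 + 1"],
    intro conjI allI impI)
  fix p :: "nat \<Rightarrow> nat" and \<sigma> \<Delta> :: "nat \<Rightarrow> real"
  assume pos: "\<forall>n. 0 < p n \<and> 0 < \<sigma> n \<and> 0 < \<Delta> n"
  show "\<forall>\<^sub>F n in sequentially.
      1 / 8 * exp (- 4 * (snr n (p n) (\<sigma> n) (\<Delta> n))\<^sup>2) \<le> minimax_risk n (p n) (\<sigma> n) (\<Delta> n) \<and>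
      minimax_risk n (p n) (\<sigma> n) (\<Delta> n) \<le> (4 * exp 1 + 1) * exp (- (1 / 16) * (snr n (p n) (\<sigma> n) (\<Delta> n))\<^sup>2)"
    using eventually_ge_at_top[of 2]
  proof eventually_elim
    case (elim n)
    with pos show ?case
      using minimax_risk_ge[of n "p n" "\<sigma> n" "\<Delta> n"] minimax_risk_le[of n "p n" "\<sigma> n" "\<Delta> n"] by simp
  qed
qed (auto intro: add_pos_pos)

end
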